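(* Let $r\ge1$ be an integer, let $\alpha=\frac{\epsilon\pi}{2r}$ with $0<\epsilon<\frac12$, and let $0<\mu<\mu_c(\alpha,2r)$. Let $H^\mu=W-\mu V_\alpha$ be the spherical harmonic of degree $2r$ on $\mathbb{S}^2$ given in spherical coordinates by $$h^\mu(\vartheta,\varphi)=\sin^{2r}(\vartheta)\sin(2r\varphi)+\mu\,\sin\vartheta\,P'_{2r}(\cos\vartheta)\,\sin(\varphi-\alpha).$$ Then: (i) $H^\mu$ has no critical zero; (ii) the nodal set $N(H^\mu)$ has exactly two connected components, i.e. it consists of exactly two simple closed curves which do not intersect. In particular, $H^\mu$ has exactly three nodal domains.
   Context: $\mathbb{S}^2\subset\mathbb{R}^3$ is the unit sphere. Spherical coordinates are $E(\vartheta,\varphi)=(\sin\vartheta\cos\varphi,\sin\vartheta\sin\varphi,\cos\vartheta)$, $\vartheta\in[0,\pi]$, $\varphi\in\mathbb{R}/2\pi\mathbb{Z}$. A spherical harmonic of degree $\ell$ is the restriction to $\mathbb{S}^2$ of a harmonic homogeneous polynomial of degree $\ell$ on $\mathbb{R}^3$. The nodal set $N(u)$ of a function $u$ on $\mathbb{S}^2$ is its zero set; nodal domains are the connected components of $\mathbb{S}^2\setminus N(u)$. A critical zero of $u$ is a point of $\mathbb{S}^2$ at which both $u$ and its differential $du$ vanish. $P_{\ell}(t)=\frac{1}{2^{\ell}\ell!}\frac{d^{\ell}}{dt^{\ell}}(t^2-1)^{\ell}$ is the Legendre polynomial. $W$ is the restriction to $\mathbb{S}^2$ of $\mathrm{Im}\,(x+iy)^{2r}$,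 i.e. $\sin^{2r}(\vartheta)\sin(2r\varphi)$; $V_\alpha$ is the spherical harmonic of degree $2r$ given by $-\sin\vartheta\,P'_{2r}(\cos\vartheta)\sin(\varphi-\alpha)$. Definition of $\mu_c(\alpha,2r)$. The polynomial $2rP_{2r}(t)-tP'_{2r}(t)$ has exactly $r-1$ zeros in $(0,1)$; write them as $\cos\omega_1>\cdots>\cos\omega_{r-1}$ with $0<\omega_1<\cdots<\omega_{r-1}<\frac{\pi}{2}$. The function $f(\varphi)=2r\cos(2r\varphi)\sin(\varphi-\alpha)-\sin(2r\varphi)\cos(\varphi-\alpha)$ has, for each $1\le j\le 2r-1$, exactly one zero $\varphi_j$ in $\left(\frac{j\pi}{2r},\frac{(j+1)\pi}{2r}\right)$. Set $$\mu_{i,j}(\alpha)=\left|\frac{\sin^{2r-1}(\omega_i)\,\sin(2r\varphi_j)}{P'_{2r}(\cos\omega_i)\,\sin(\varphi_j-\alpha)}\right|,\qquad \mu_c(\alpha,2r)=\inf_{1\le i\le r-1,\ 1\le j\le 2r-1}\mu_{i,j}(\alpha)$$ (the denominators do not vanish); for $r=1$ the index set is empty and $\mu_c(\alpha,2)=+\infty$. *)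

theory Defs
  imports "HOL-Analysis.Analysis" "HOL-Computational_Algebra.Polynomial"
begin

definition sphere2 :: "(real^3) set" where
  "sphere2 = sphere 0 1"

definition sph :: "real \<Rightarrow> real \<Rightarrow> real^3" where
  "sph \<theta> \<phi> = vector [sin \<theta> * cos \<phi>, sin \<theta> * sin \<phi>, cos \<theta>]"

definition laplacian :: "(real^3 \<Rightarrow> real) \<Rightarrow> real^3 \<Rightarrow> real" where
  "laplacian Q x = (\<Sum>i\<in>UNIV. deriv (deriv (\<lambda>t. Q (x + t *\<^sub>R axis i 1))) 0)"

text \<open>
  A function on the sphere is represented by a function on the ambient space, of which only the
  values on the sphere matter in every notion below.
\<close>

definition spherical_harmonic :: "nat \<Rightarrow> (real^3 \<Rightarrow> real) \<Rightarrow> bool" where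
  "spherical_harmonic l u \<longleftrightarrow>
     (\<exists>Q. real_polynomial_function Q \<and>
          (\<forall>c x. Q (c *\<^sub>R x) = c ^ l * Q x) \<and>
          (\<forall>x. laplacian Q x = 0) \<and>
          (\<forall>p\<in>sphere2. u p = Q p))"

definition nodal_set :: "(real^3 \<Rightarrow> real) \<Rightarrow> (real^3) set" where
  "nodal_set u = {p \<in> sphere2. u p = 0}"

definition nodal_domains :: "(real^3 \<Rightarrow> real) \<Rightarrow> (real^3) set set" where
  "nodal_domains u = components (sphere2 - nodal_set u)"

text \<open>
  The derivative of \<open>u\<close> at \<open>p\<close> within the sphere is determined only on the tangent space
  \<open>{v. v \<bullet> p = 0}\<close>; its restriction to that space is the differential of \<open>u\<close> as a function on
  the sphere.
\<close>

definition critical_zero :: "(real^3 \<Rightarrow> real) \<Rightarrow> real^3 \<Rightarrow> bool" where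
  "critical_zero u p \<longleftrightarrow>
     p \<in> sphere2 \<and> u p = 0 \<and>
     (\<exists>D. (u has_derivative D) (at p within sphere2) \<and> (\<forall>v. v \<bullet> p = 0 \<longrightarrow> D v = 0))"

definition simple_closed_curve :: "(real \<Rightarrow> real^3) \<Rightarrow> bool" where
  "simple_closed_curve \<gamma> \<longleftrightarrow> simple_path \<gamma> \<and> pathfinish \<gamma> = pathstart \<gamma>"

definition legendre :: "nat \<Rightarrow> real poly" where
  "legendre l = smult (1 / (2 ^ l * fact l)) ((pderiv ^^ l) ([:-1, 0, 1:] ^ l))"

definition harm_W :: "nat \<Rightarrow> real^3 \<Rightarrow> real" where
  "harm_W r p = Im (Complex (p $ 1) (p $ 2) ^ (2 * r))"

text \<open>
  On the sphere, \<open>sin \<theta> * sin (\<phi> - \<alpha>)\<close> is \<open>y * cos \<alpha> - x * sin \<alpha>\<close> and \<open>cos \<theta>\<close> is \<open>z\<close>;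
  see \<open>harm_V_sph\<close> below. Off the sphere this expression is not the homogeneous harmonic extension.
\<close>

definition harm_V :: "nat \<Rightarrow> real \<Rightarrow> real^3 \<Rightarrow> real" where
  "harm_V r \<alpha> p = - poly (pderiv (legendre (2 * r))) (p $ 3) * (p $ 2 * cos \<alpha> - p $ 1 * sin \<alpha>)"

definition harm_H :: "nat \<Rightarrow> real \<Rightarrow> real \<Rightarrow> real^3 \<Rightarrow> real" where
  "harm_H r \<alpha> \<mu> p = harm_W r p - \<mu> * harm_V r \<alpha> p"

lemma harm_W_sph: "harm_W r (sph \<theta> \<phi>) = sin \<theta> ^ (2 * r) * sin (real (2 * r) * \<phi>)"
proof -
  have "Complex (sin \<theta> * cos \<phi>) (sin \<theta> * sin \<phi>) = of_real (sin \<theta>) * cis \<phi>"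
    by (simp add: complex_eq_iff)
  moreover have "(of_real (sin \<theta>) * cis \<phi>) ^ (2 * r) =
      of_real (sin \<theta> ^ (2 * r)) * cis (real (2 * r) * \<phi>)"
    by (simp only: power_mult_distrib Complex.DeMoivre of_real_power)
  ultimately show ?thesis
    by (simp only: harm_W_def sph_def vector_3 times_complex.sel cis.sel
        Re_complex_of_real Im_complex_of_real)
qed

lemma harm_V_sph:
  "harm_V r \<alpha> (sph \<theta> \<phi>) =
     - sin \<theta> * poly (pderiv (legendre (2 * r))) (cos \<theta>) * sin (\<phi> - \<alpha>)"
  by (simp add: harm_V_def sph_def vector_3 sin_diff algebra_simps)

lemma range_sph: "(\<lambda>(\<theta>, \<phi>). sph \<theta> \<phi>) ` ({0..pi} \<times> UNIV) = sphere2"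
proof -
  have iff: "p \<in> sphere2 \<longleftrightarrow> (p $ 1)\<^sup>2 + (p $ 2)\<^sup>2 + (p $ 3)\<^sup>2 = 1" for p
    by (simp add: sphere2_def norm_eq_1 inner_vec_def sum_3 power2_eq_square)
  have "sph \<theta> \<phi> \<in> sphere2" for \<theta> \<phi>
  proof -
    have "(sin \<theta> * cos \<phi>)\<^sup>2 + (sin \<theta> * sin \<phi>)\<^sup>2 = (sin \<theta>)\<^sup>2 * ((cos \<phi>)\<^sup>2 + (sin \<phi>)\<^sup>2)"
      by (simp only: power_mult_distrib distrib_left)
    then show ?thesis
      by (simp only: iff sph_def vector_3) simp
  qed
  moreover have "\<exists>\<theta>\<in>{0..pi}. \<exists>\<phi>. p = sph \<theta> \<phi>" if "p \<in> sphere2" for p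
  proof -
    obtain s \<phi> where s: "p $ 1 = s * cos \<phi>" "p $ 2 = s * sin \<phi>" "0 \<le> s"
    proof -
      obtain s \<phi> where s: "p $ 1 = s * cos \<phi>" "p $ 2 = s * sin \<phi>"
        using polar_Ex by blast
      show ?thesis
      proof (cases "0 \<le> s")
        case True
        then show ?thesis using s that by blast
      next
        case False
        then show ?thesis using s that [of "- s" "\<phi> + pi"] by simp
      qed
    qed
    have "(p $ 1)\<^sup>2 + (p $ 2)\<^sup>2 = s\<^sup>2 * ((cos \<phi>)\<^sup>2 + (sin \<phi>)\<^sup>2)"
      by (simp only: s power_mult_distrib distrib_left)
    then have "(p $ 3)\<^sup>2 + s\<^sup>2 = 1"
      using that by (simp add: iff)
    then obtain \<theta> where "0 \<le> \<theta>" "\<theta> \<le> pi" "p $ 3 = cos \<theta>" "s = sin \<theta>"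
      using sincos_total_pi [OF s(3)] by blast
    then show ?thesis
      using s by (intro bexI [of _ \<theta>] exI [of _ \<phi>]) (auto simp: vec_eq_iff forall_3 sph_def)
  qed
  ultimately show ?thesis
    by force
qed

text \<open>
  The numbers \<open>0 < \<omega>\<^sub>1 < \<dots> < \<omega>\<^bsub>r-1\<^esub> < pi/2\<close>, in increasing order; indices start at 1.
\<close>

definition omega :: "nat \<Rightarrow> nat \<Rightarrow> real" where
  "omega r i =
     sorted_list_of_set
       {\<omega>. 0 < \<omega> \<and> \<omega> < pi / 2 \<and>
            real (2 * r) * poly (legendre (2 * r)) (cos \<omega>)
              - cos \<omega> * poly (pderiv (legendre (2 * r))) (cos \<omega>) = 0} ! (i - 1)"

definition phi :: "nat \<Rightarrow> real \<Rightarrow> nat \<Rightarrow> real" where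
  "phi r \<alpha> j =
     (THE \<phi>. real j * pi / (2 * real r) < \<phi> \<and> \<phi> < (real j + 1) * pi / (2 * real r) \<and>
        real (2 * r) * cos (real (2 * r) * \<phi>) * sin (\<phi> - \<alpha>)
          - sin (real (2 * r) * \<phi>) * cos (\<phi> - \<alpha>) = 0)"

definition mu_ij :: "nat \<Rightarrow> real \<Rightarrow> nat \<Rightarrow> nat \<Rightarrow> real" where
  "mu_ij r \<alpha> i j =
     \<bar>(sin (omega r i) ^ (2 * r - 1) * sin (real (2 * r) * phi r \<alpha> j))
       / (poly (pderiv (legendre (2 * r))) (cos (omega r i)) * sin (phi r \<alpha> j - \<alpha>))\<bar>"

text \<open>The infimum is taken in the extended reals, so that it is \<open>\<infinity>\<close> for \<open>r = 1\<close>.\<close>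

definition mu_c :: "nat \<Rightarrow> real \<Rightarrow> ereal" where
  "mu_c r \<alpha> = (INF (i, j) \<in> {1..r - 1} \<times> {1..2 * r - 1}. ereal (mu_ij r \<alpha> i j))"

end

(*
  Dividing by sin^(2r) th * sin (ph - alpha), the equation h(th, ph) = 0 becomes X th = Y ph with
  X th = mu P'(cos th) / sin^(2r-1) th on (0, pi) and Y ph = - sin (2 r ph) / sin (ph - alpha) on
  (alpha, alpha + pi); the opposite half of the sphere is the antipodal image, and on the two
  meridians in between h is positive.  The critical points of X and Y are the omega_i, pi - omega_i
  and the phi_j, and mu < mu_c says that every critical value of X is smaller in absolute value
  than every critical value of Y.  Hence no zero is critical in both variables.

  Choose M between the two sets of critical values.  X is monotone where |X| >= M, and Y runs
  monotonically through [-M, M] on each of 2r branches.  So the zigzag of X inside [-M, M] can be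
  straightened: replacing X there by a linear function turns {X = Y} into a graph over the
  ph-interval, and moving each point along its branch of Y carries this graph to {X = Y}.  As Y
  tends to minus infinity at both ends, the level curve is an arc which closes up at the south
  pole.  The same two facts about M let one move inside {X > Y} to the north and inside {X < Y} to
  the south, which yields the connectedness of the nodal domains.
*)
theory Submission
  imports Defs
begin

section \<open>Legendre polynomials\<close>

text \<open>By Legendre's equation X' is a positive multiple of 2rP - tP' at t = cos th, divided by
  sin^(2r) th, and Y' is -f / sin^2 (ph - \<alpha>); so \<open>mu_ij\<close> is a ratio of critical
  values |Y| / |X| with \<mu> scaled out of X. The leading terms of 2rP and tP' cancel, which leaves
  at most r - 1 zeros in (0,1): every critical point of X in (0, pi/2) has an index in the range of
  the infimum.

  The obstacle is that both profiles oscillate, so {X = Y} is in general a graph over neither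
  variable. X can be changed inside the band [-M, M] because Y crosses that band on monotone
  branches only: a change of the value of X is compensated by a move in ph. A second level L > M,
  still below the critical values of Y, serves continuity. Where M < |Y| < L the move along a branch
  is the identity, so the two descriptions of the deformation agree on an open overlap.

  The bounds on \<alpha> give sin (2 r \<alpha>) > 0, which decides both the sign of H on the
  separating meridians and the limits of Y at the ends.\<close>

lemma pderiv_quadratic_power:
  "[:-1, 0, 1:] * pderiv ([:-1, 0, 1:] ^ l) = smult (2 * real l) ([:0, 1:] * [:-1, 0, 1::real:] ^ l)"
proof (cases l)
  case (Suc m)
  have "pderiv [:-1, 0, 1::real:] = smult 2 [:0, 1:]"
    by (simp add: pderiv_pCons)
  then show ?thesis
    unfolding Suc pderiv_power_Suc by (simp add: mult_ac)
qed simp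

text \<open>Comparison of the coefficients of degree k + 1 in the first-order equation (t^2 - 1) u'
  = 2 l t u.\<close>

lemma coeff_quadratic_power_rec:
  fixes l k :: nat
  defines "u \<equiv> [:-1, 0, 1::real:] ^ l"
  shows "real (k + 2) * coeff u (k + 2) = (real k - 2 * real l) * coeff u k"
proof -
  have "coeff ([:-1, 0, 1:] * pderiv u) (Suc k) = coeff (smult (2 * real l) ([:0, 1:] * u)) (Suc k)"
    unfolding u_def pderiv_quadratic_power ..
  then have "(case k of 0 \<Rightarrow> 0 | Suc m \<Rightarrow> coeff (pderiv u) m) - coeff (pderiv u) (Suc k) =
      2 * real l * coeff u k"
    by (simp add: coeff_pCons split: nat.splits)
  moreover have "(case k of 0 \<Rightarrow> 0 | Suc m \<Rightarrow> coeff (pderiv u) m) = real k * coeff u k"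
    by (simp add: coeff_pderiv split: nat.splits)
  moreover have "coeff (pderiv u) (Suc k) = real (k + 2) * coeff u (k + 2)"
    by (simp add: coeff_pderiv)
  ultimately show ?thesis
    by (simp only: left_diff_distrib)
qed

lemma coeff_legendre:
  "coeff (legendre l) j =
     pochhammer (real (Suc j)) l * coeff ([:-1, 0, 1:] ^ l) (j + l) / (2 ^ l * fact l)"
  by (simp add: legendre_def coeff_higher_pderiv)

lemma coeff_legendre_rec:
  "real (j + 2) * real (j + 1) * coeff (legendre l) (j + 2) =
     (real j * real (j + 1) - real l * real (l + 1)) * coeff (legendre l) j"
proof -
  define u where "u = [:-1, 0, 1::real:] ^ l"
  define A where "A = pochhammer (real (Suc j)) l"
  define B where "B = pochhammer (real (Suc (j + 2))) l"
  \<comment> \<open>The Pochhammer symbol of length l + 2 is split once at its lower and once at its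
    upper end.\<close>
  have poch: "real (j + 2) * real (j + 1) * B = A * real (j + l + 1) * real (j + l + 2)"
  proof -
    have "pochhammer (real (Suc j)) (2 + l) = real (j + 1) * real (j + 2) * B"
      unfolding B_def pochhammer_product' [of _ 2] by (simp add: eval_nat_numeral pochhammer_Suc algebra_simps)
    moreover have "pochhammer (real (Suc j)) (l + 2) = A * real (j + l + 1) * real (j + l + 2)"
      unfolding A_def by (simp add: eval_nat_numeral pochhammer_Suc algebra_simps)
    ultimately show ?thesis by (simp add: add.commute mult.commute)
  qed
  have "real (j + l + 2) * coeff u (j + l + 2) = (real (j + l) - 2 * real l) * coeff u (j + l)"
    unfolding u_def by (rule coeff_quadratic_power_rec)
  then have "real (j + 2) * real (j + 1) * B * coeff u (j + l + 2) =
      (real j - real l) * real (j + l + 1) * A * coeff u (j + l)"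
    unfolding poch by (simp add: mult_ac)
  then show ?thesis
    unfolding coeff_legendre u_def [symmetric] A_def [symmetric] B_def [symmetric]
    by (simp add: field_simps)
qed

text \<open>Legendre's equation is the coefficient recurrence read as an identity of
  polynomials.\<close>

lemma legendre_ode:
  "(1 - t\<^sup>2) * poly (pderiv (pderiv (legendre l))) t =
     2 * t * poly (pderiv (legendre l)) t - real l * (real l + 1) * poly (legendre l) t"
proof -
  let ?P = "legendre l"
  have "[:1, 0, -1:] * pderiv (pderiv ?P) = [:0, 2:] * pderiv ?P - smult (real l * (real l + 1)) ?P"
  proof (rule poly_eqI)
    fix k
    have "real (k + 2) * real (k + 1) * coeff ?P (k + 2) =
        (real k * real (k + 1) - real l * real (l + 1)) * coeff ?P k"
      by (rule coeff_legendre_rec)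
    then show "coeff ([:1, 0, -1:] * pderiv (pderiv ?P)) k =
        coeff ([:0, 2:] * pderiv ?P - smult (real l * (real l + 1)) ?P) k"
      by (auto simp: coeff_pderiv coeff_pCons algebra_simps split: nat.splits)
  qed
  then have "poly ([:1, 0, -1:] * pderiv (pderiv ?P)) t =
    poly ([:0, 2:] * pderiv ?P - smult (real l * (real l + 1)) ?P) t" by simp
  then show ?thesis by (simp add: algebra_simps power2_eq_square)
qed

lemma coeff_legendre_parity:
  assumes "odd (j + l)"
  shows "coeff (legendre l) j = 0"
proof -
  have "odd k \<Longrightarrow> coeff ([:-1, 0, 1::real:] ^ l) k = 0" for k
  proof (induction l arbitrary: k)
    case 0
    then show ?case by (auto simp: odd_pos)
  next
    case (Suc l)
    then show ?case by (auto simp: coeff_pCons split: nat.splits)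
  qed
  then show ?thesis using assms by (simp add: coeff_legendre)
qed

lemma coeff_legendre_beyond:
  assumes "l < j"
  shows "coeff (legendre l) j = 0"
proof -
  have "degree ([:-1, 0, 1::real:] ^ l) \<le> 2 * l"
    using degree_power_le [of "[:-1, 0, 1::real:]" l] by simp
  then show ?thesis using assms by (simp add: coeff_legendre coeff_eq_0)
qed

lemma pcompose_power: "pcompose (p ^ m) q = pcompose p q ^ m"
  for p q :: "real poly"
  by (induction m) (simp_all add: pcompose_mult pcompose_1)

lemma higher_pderiv_shift: "(pderiv ^^ m) (pcompose p [:c, 1:]) = pcompose ((pderiv ^^ m) p) [:c, 1:]"
  for c :: real
  by (induction m) (simp_all add: pderiv_pcompose pderiv_pCons)

text \<open>After the shift t = 1 + x the power (t^2 - 1)^l is x^l (x + 2)^l, whose l-th derivative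
  at 0 is l! times the constant term 2^l of the second factor.\<close>

lemma poly_legendre_1: "poly (legendre l) 1 = 1"
proof -
  let ?u = "[:-1, 0, 1::real:] ^ l"
  have "pcompose ?u [:1, 1:] = monom 1 l * [:2, 1:] ^ l"
    by (simp add: pcompose_power pcompose_pCons monom_altdef flip: power_mult_distrib)
  then have "poly ((pderiv ^^ l) ?u) 1 = poly ((pderiv ^^ l) (monom 1 l * [:2, 1:] ^ l)) 0"
    using higher_pderiv_shift [of l ?u 1] by (simp add: poly_pcompose)
  also have "\<dots> = coeff ((pderiv ^^ l) (monom 1 l * [:2, 1:] ^ l)) 0"
    by (simp add: poly_0_coeff_0)
  also have "\<dots> = fact l * coeff ([:2, 1:] ^ l) 0"
    by (simp add: coeff_higher_pderiv coeff_monom_mult pochhammer_fact)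
  also have "coeff ([:2, 1::real:] ^ l) 0 = 2 ^ l"
    by (induction l) simp_all
  finally show ?thesis by (simp add: legendre_def)
qed

text \<open>At t = 1 the second-order term of Legendre's equation drops out. The value governs H
  near the poles.\<close>

lemma poly_pderiv_legendre_1: "poly (pderiv (legendre l)) 1 = real l * (real l + 1) / 2"
  using legendre_ode [of 1 l] by (simp add: poly_legendre_1)

text \<open>The recurrence has step two, so a vanishing constant term would remove all even
  coefficients; parity removes the odd ones, against P(1) = 1. It ensures that the equator is not
  critical for X.\<close>

lemma poly_legendre_0_nonzero:
  assumes "even l"
  shows "poly (legendre l) 0 \<noteq> 0"
proof
  assume "poly (legendre l) 0 = 0"
  then have 0: "coeff (legendre l) 0 = 0" by (simp add: poly_0_coeff_0)
  have "coeff (legendre l) (2 * j) = 0" for j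
  proof (induction j)
    case (Suc j)
    then show ?case using coeff_legendre_rec [of "2 * j" l] by simp
  qed (simp add: 0)
  moreover have "coeff (legendre l) j = 0" if "odd j" for j
    using that assms by (simp add: coeff_legendre_parity)
  ultimately have "coeff (legendre l) j = 0" for j by (cases "even j") (auto elim: evenE)
  then have "legendre l = 0" by (simp add: poly_eqI)
  then show False using poly_legendre_1 [of l] by simp
qed

lemma poly_parity:
  fixes p :: "real poly"
  assumes "\<And>j. odd (j + m) \<Longrightarrow> coeff p j = 0"
  shows "poly p (- t) = (-1) ^ m * poly p t"
proof -
  have "coeff p j * (- t) ^ j = (-1) ^ m * (coeff p j * t ^ j)" for j
    using assms [of j] by (cases "even j"; cases "even m") auto
  then show ?thesis unfolding poly_altdef sum_distrib_left by (rule sum.cong [OF refl])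
qed

lemma poly_legendre_minus: "poly (legendre l) (- t) = (-1) ^ l * poly (legendre l) t"
  by (intro poly_parity coeff_legendre_parity)

lemma poly_pderiv_legendre_minus:
  assumes "even l"
  shows "poly (pderiv (legendre l)) (- t) = - poly (pderiv (legendre l)) t"
  using poly_parity [of 1 "pderiv (legendre l)" t] assms
  by (simp add: coeff_pderiv coeff_legendre_parity)

section \<open>The harmonic extension\<close>

lemma laplacian_eqI:
  assumes "\<And>i t. ((\<lambda>t. Q (x + t *\<^sub>R axis i 1)) has_real_derivative f i t) (at t)"
    and "\<And>i. (f i has_real_derivative g i) (at 0)"
  shows "laplacian Q x = g 1 + g 2 + g 3"
proof -
  have "deriv (\<lambda>t. Q (x + t *\<^sub>R axis i 1)) = f i" for i
    using assms(1) by (intro ext DERIV_imp_deriv)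
  then have "deriv (deriv (\<lambda>t. Q (x + t *\<^sub>R axis i 1))) 0 = g i" for i
    using DERIV_imp_deriv [OF assms(2)] by metis
  then show ?thesis by (simp add: laplacian_def sum_3)
qed

text \<open>\<open>deriv\<close> is unspecified where there is no derivative, so
  \<open>laplacian\<close> alone does not respect sums. The predicate carries actual derivatives
  along the coordinate lines and is therefore closed under linear combinations.\<close>

definition has_laplacian :: "(real^3 \<Rightarrow> real) \<Rightarrow> (real^3 \<Rightarrow> real) \<Rightarrow> bool" where
  "has_laplacian Q l \<longleftrightarrow> (\<forall>x. \<exists>f g.
     (\<forall>i t. ((\<lambda>t. Q (x + t *\<^sub>R axis i 1)) has_real_derivative f i t) (at t)) \<and>
     (\<forall>i. (f i has_real_derivative g i) (at 0)) \<and> l x = g 1 + g 2 + g 3)"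

lemma has_laplacian_imp: "has_laplacian Q l \<Longrightarrow> laplacian Q x = l x"
  unfolding has_laplacian_def using laplacian_eqI by metis

lemma has_laplacianI:
  assumes "\<And>x i t. ((\<lambda>t. Q (x + t *\<^sub>R axis i 1)) has_real_derivative f x i t) (at t)"
    and "\<And>x i. (f x i has_real_derivative g x i) (at 0)"
    and "\<And>x. l x = g x 1 + g x 2 + g x 3"
  shows "has_laplacian Q l"
  using assms unfolding has_laplacian_def by metis

lemma has_laplacian_add:
  assumes "has_laplacian P k" "has_laplacian Q l"
  shows "has_laplacian (\<lambda>x. P x + Q x) (\<lambda>x. k x + l x)"
  unfolding has_laplacian_def
proof
  fix x
  obtain f g where 1: "\<And>i t. ((\<lambda>t. P (x + t *\<^sub>R axis i 1)) has_real_derivative f i t) (at t)"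
     "\<And>i. (f i has_real_derivative g i) (at 0)" "k x = g 1 + g 2 + g 3"
    using assms(1) unfolding has_laplacian_def by metis
  obtain f' g' where 2: "\<And>i t. ((\<lambda>t. Q (x + t *\<^sub>R axis i 1)) has_real_derivative f' i t) (at t)"
     "\<And>i. (f' i has_real_derivative g' i) (at 0)" "l x = g' 1 + g' 2 + g' 3"
    using assms(2) unfolding has_laplacian_def by metis
  show "\<exists>f g. (\<forall>i t. ((\<lambda>t. P (x + t *\<^sub>R axis i 1) + Q (x + t *\<^sub>R axis i 1)) has_real_derivative f i t) (at t)) \<and>
     (\<forall>i. (f i has_real_derivative g i) (at 0)) \<and> k x + l x = g 1 + g 2 + g 3"
    by (rule exI [of _ "\<lambda>i t. f i t + f' i t"], rule exI [of _ "\<lambda>i. g i + g' i"])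
      (intro conjI allI DERIV_add 1 2, simp add: 1 2)
qed

lemma has_laplacian_cmult:
  assumes "has_laplacian P k"
  shows "has_laplacian (\<lambda>x. c * P x) (\<lambda>x. c * k x)"
  unfolding has_laplacian_def
proof
  fix x
  obtain f g where 1: "\<And>i t. ((\<lambda>t. P (x + t *\<^sub>R axis i 1)) has_real_derivative f i t) (at t)"
     "\<And>i. (f i has_real_derivative g i) (at 0)" "k x = g 1 + g 2 + g 3"
    using assms(1) unfolding has_laplacian_def by metis
  show "\<exists>f g. (\<forall>i t. ((\<lambda>t. c * P (x + t *\<^sub>R axis i 1)) has_real_derivative f i t) (at t)) \<and>
     (\<forall>i. (f i has_real_derivative g i) (at 0)) \<and> c * k x = g 1 + g 2 + g 3"
    by (rule exI [of _ "\<lambda>i t. c * f i t"], rule exI [of _ "\<lambda>i. c * g i"])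
      (intro conjI allI DERIV_cmult 1, simp add: 1 algebra_simps)
qed

lemma has_laplacian_sum:
  assumes "finite I" "\<And>i. i \<in> I \<Longrightarrow> has_laplacian (P i) (k i)"
  shows "has_laplacian (\<lambda>x. \<Sum>i\<in>I. P i x) (\<lambda>x. \<Sum>i\<in>I. k i x)"
  using assms
proof (induction I)
  case empty
  show ?case
    by (rule has_laplacianI [where f = "\<lambda>_ _ _. 0" and g = "\<lambda>_ _. 0"]) auto
qed (simp add: has_laplacian_add)

text \<open>The second derivatives of a power of x + iy along the axes differ only by the squared
  directions 1, i^2 and 0, whose sum is 0.\<close>

lemma has_laplacian_Im_power: "has_laplacian (\<lambda>p. Im (Complex (p $ 1) (p $ 2) ^ N)) (\<lambda>p. 0)"
proof -
  define w where "w i = (if i = 1 then 1 else if i = 2 then \<i> else 0)" for i :: 3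
  \<comment> \<open>The prefactor \<open>a\<close> lets the rule be applied again to the first
    derivative.\<close>
  have aux: "((\<lambda>t. Im (a * (z + of_real t * v) ^ N)) has_real_derivative
      Im (of_nat N * v * a * (z + of_real t * v) ^ (N - 1))) (at t)" for a z v N t
  proof -
    have "((\<lambda>s. a * (z + s * v) ^ N) has_field_derivative
        of_nat N * v * a * (z + of_real t * v) ^ (N - 1)) (at (of_real t))"
      by (rule derivative_eq_intros refl | simp)+
    then have "((\<lambda>s. a * (z + of_real s * v) ^ N) has_vector_derivative
        of_nat N * v * a * (z + of_real t * v) ^ (N - 1)) (at t)"
      by (rule has_vector_derivative_real_field)
    then show ?thesis
      unfolding has_real_derivative_iff_has_vector_derivative
      by (rule bounded_linear.has_vector_derivative [OF bounded_linear_Im])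
  qed
  have eq: "Complex ((x + t *\<^sub>R axis i 1) $ 1) ((x + t *\<^sub>R axis i 1) $ 2) =
      Complex (x $ 1) (x $ 2) + of_real t * w i" for x :: "real^3" and t i
    using exhaust_3 [of i] by (auto simp: w_def axis_def complex_eq_iff)
  let ?z = "\<lambda>x::real^3. Complex (x $ 1) (x $ 2)"
  show ?thesis
  proof (rule has_laplacianI)
    fix x :: "real^3" and i :: 3 and t :: real
    show "((\<lambda>t. Im (?z (x + t *\<^sub>R axis i 1) ^ N)) has_real_derivative
        Im (of_nat N * w i * (?z x + of_real t * w i) ^ (N - 1))) (at t)"
      using aux [of 1 "?z x" "w i" N t] by (simp only: eq mult_1_left mult_1_right)
    show "((\<lambda>t. Im (of_nat N * w i * (?z x + of_real t * w i) ^ (N - 1))) has_real_derivative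
        Im (of_nat (N - 1) * w i * (of_nat N * w i) * (?z x + of_real 0 * w i) ^ (N - 1 - 1))) (at 0)"
      by (rule aux)
    show "0 = Im (of_nat (N - 1) * w 1 * (of_nat N * w 1) * (?z x + of_real 0 * w 1) ^ (N - 1 - 1)) +
       Im (of_nat (N - 1) * w 2 * (of_nat N * w 2) * (?z x + of_real 0 * w 2) ^ (N - 1 - 1)) +
       Im (of_nat (N - 1) * w 3 * (of_nat N * w 3) * (?z x + of_real 0 * w 3) ^ (N - 1 - 1))"
      by (simp add: w_def flip: distrib_left)
  qed
qed

lemma inner_self_3: "p \<bullet> p = (p $ 1)\<^sup>2 + (p $ 2)\<^sup>2 + (p $ 3)\<^sup>2" for p :: "real^3"
  by (simp add: inner_vec_def sum_3 power2_eq_square)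

lemma mult_power_pred: "real k * (x ^ (k - 1) * x) = real k * x ^ k"
  by (cases k) simp_all

lemma mult_power_pred2: "real k * real (k - 1) * (x ^ (k - 2) * x) = real k * real (k - 1) * x ^ (k - 1)"
  by (cases k; cases "k - 1") (simp_all add: eval_nat_numeral)

text \<open>Product rule with S the linear factor and R = |p|^2. S is harmonic and its gradient is
  orthogonal to that of z^k. The other two cross terms contribute 4m and 4km by Euler's identity,
  and R^m contributes 2m(2m + 1); together 2m(2m + 2k + 3).\<close>

lemma has_laplacian_monomial:
  "has_laplacian (\<lambda>p. (p $ 2 * b - p $ 1 * a) * p $ 3 ^ k * (p \<bullet> p) ^ m)
     (\<lambda>p. (p $ 2 * b - p $ 1 * a) * (real k * real (k - 1) * p $ 3 ^ (k - 2) * (p \<bullet> p) ^ m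
        + 2 * real m * (2 * real m + 2 * real k + 3) * p $ 3 ^ k * (p \<bullet> p) ^ (m - 1)))"
proof -
  define e where "e i j = (if i = j then 1 else 0 :: real)" for i j :: 3
  have nth: "(x + t *\<^sub>R axis i 1) $ j = x $ j + t * e i j" for x t i j
    by (simp add: axis_def e_def)
  let ?x = "\<lambda>x i t j. x $ j + t * e i j"
  let ?r = "\<lambda>x i t. (?x x i t 1)\<^sup>2 + (?x x i t 2)\<^sup>2 + (?x x i t 3)\<^sup>2"
  let ?r' = "\<lambda>x i t. 2 * (?x x i t 1 * e i 1 + ?x x i t 2 * e i 2 + ?x x i t 3 * e i 3)"
  let ?s = "\<lambda>x i t. ?x x i t 2 * b - ?x x i t 1 * a"
  let ?s' = "\<lambda>i. e i 2 * b - e i 1 * a"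
  have r: "((\<lambda>t. ?r x i t ^ m) has_real_derivative real m * ?r x i t ^ (m - 1) * ?r' x i t) (at t)"
    for x i t m
    by (auto intro!: derivative_eq_intros simp: algebra_simps)
  have z: "((\<lambda>t. ?x x i t 3 ^ k) has_real_derivative real k * ?x x i t 3 ^ (k - 1) * e i 3) (at t)"
    for x i t k
    by (auto intro!: derivative_eq_intros)
  have s: "((\<lambda>t. ?s x i t) has_real_derivative ?s' i) (at t)" for x i t
    by (auto intro!: derivative_eq_intros)
  have r': "((\<lambda>t. ?r' x i t) has_real_derivative 2 * (e i 1 * e i 1 + e i 2 * e i 2 + e i 3 * e i 3)) (at t)" for x i t
    by (auto intro!: derivative_eq_intros)
  let ?f = "\<lambda>x i t. ?s' i * (?x x i t 3 ^ k * ?r x i t ^ m)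
     + (?s x i t * ((real k * ?x x i t 3 ^ (k - 1) * e i 3) * ?r x i t ^ m)
     +  ?s x i t * (?x x i t 3 ^ k * (real m * ?r x i t ^ (m - 1) * ?r' x i t)))"
  define g where "g x i =
      ?s' i * (real k * x $ 3 ^ (k - 1) * e i 3 * (x \<bullet> x) ^ m + x $ 3 ^ k * (real m * (x \<bullet> x) ^ (m - 1) * ?r' x i 0)) * 2
      + ?s x i 0 * (real k * (real (k - 1) * x $ 3 ^ (k - 2) * e i 3) * e i 3 * (x \<bullet> x) ^ m
        + 2 * (real k * x $ 3 ^ (k - 1) * e i 3 * (real m * (x \<bullet> x) ^ (m - 1) * ?r' x i 0))
        + x $ 3 ^ k * (real m * (real (m - 1) * (x \<bullet> x) ^ (m - 2) * ?r' x i 0) * ?r' x i 0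
          + real m * (x \<bullet> x) ^ (m - 1) * (2 * (e i 1 * e i 1 + e i 2 * e i 2 + e i 3 * e i 3))))" for x i
  show ?thesis
  proof (rule has_laplacianI [where f = ?f and g = g])
    fix x :: "real^3" and i :: 3 and t :: real
    show "((\<lambda>t. ((x + t *\<^sub>R axis i 1) $ 2 * b - (x + t *\<^sub>R axis i 1) $ 1 * a) * (x + t *\<^sub>R axis i 1) $ 3 ^ k *
           ((x + t *\<^sub>R axis i 1) \<bullet> (x + t *\<^sub>R axis i 1)) ^ m) has_real_derivative ?f x i t) (at t)"
      unfolding inner_self_3 nth
      by (rule derivative_eq_intros s z r refl)+ (simp add: algebra_simps)
    show "(?f x i has_real_derivative g x i) (at 0)"
      unfolding g_def inner_self_3
      by (rule derivative_eq_intros s z r r' refl)+ (simp add: algebra_simps eval_nat_numeral)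
    \<comment> \<open>For m < 2 the exponent m - 2 is truncated, but then the factor m (m - 1) is
      0.\<close>
    have m: "real m * real (m - 1) * ((x \<bullet> x) ^ (m - 2) * (x \<bullet> x)) = real m * real (m - 1) * (x \<bullet> x) ^ (m - 1)"
      by (rule mult_power_pred2)
    have k: "real k * (x $ 3 ^ (k - 1) * x $ 3) = real k * x $ 3 ^ k"
      by (rule mult_power_pred)
    have m1: "real m * real (m - 1) = real m * (real m - 1)"
      by (cases m) simp_all
    define S where "S = x $ 2 * b - x $ 1 * a"
    define A where "A = real k * real (k - 1) * x $ 3 ^ (k - 2) * (x \<bullet> x) ^ m"
    define Z where "Z = x $ 3 ^ k"
    define R where "R = (x \<bullet> x) ^ (m - 1)"
    have "g x 1 + g x 2 + g x 3 = 4 * Z * (real m * R) * S + S * A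
       + S * 4 * (real k * (x $ 3 ^ (k - 1) * x $ 3)) * (real m * R)
       + S * Z * 4 * (real m * real (m - 1) * ((x \<bullet> x) ^ (m - 2) * ((x$1)\<^sup>2 + (x$2)\<^sup>2 + (x$3)\<^sup>2)))
       + S * Z * 6 * (real m * R)"
      unfolding g_def e_def S_def A_def Z_def R_def by (simp add: algebra_simps power2_eq_square)
    also have "\<dots> = 4 * Z * (real m * R) * S + S * A + S * 4 * (real k * Z) * (real m * R)
       + S * Z * 4 * (real m * (real m - 1) * R) + S * Z * 6 * (real m * R)"
      unfolding inner_self_3 [symmetric] m [unfolded m1] k m1 Z_def R_def ..
    also have "\<dots> = S * (A + 2 * real m * (2 * real m + 2 * real k + 3) * Z * R)"
      by (simp add: algebra_simps)
    finally show "(x $ 2 * b - x $ 1 * a) * (real k * real (k - 1) * x $ 3 ^ (k - 2) * (x \<bullet> x) ^ m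
        + 2 * real m * (2 * real m + 2 * real k + 3) * x $ 3 ^ k * (x \<bullet> x) ^ (m - 1)) =
      g x 1 + g x 2 + g x 3"
      by (simp add: S_def A_def Z_def R_def)
  qed
qed

section \<open>The homogeneous harmonic polynomial that extends V\<close>

lemma real_polynomial_function_nth: "real_polynomial_function (\<lambda>p::real^'n. p $ i)"
  by (intro real_polynomial_function.intros(1) bounded_linear_vec_nth)

lemma real_polynomial_function_inner_self: "real_polynomial_function (\<lambda>p::real^3. p \<bullet> p)"
  unfolding inner_self_3
  by (intro real_polynomial_function.intros(3) real_polynomial_function_power real_polynomial_function_nth)

lemma real_polynomial_function_complex_power:
  "real_polynomial_function (\<lambda>p::real^3. Re (Complex (p $ 1) (p $ 2) ^ N)) \<and>
   real_polynomial_function (\<lambda>p::real^3. Im (Complex (p $ 1) (p $ 2) ^ N))"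
proof (induction N)
  case (Suc N)
  then show ?case
    by (simp only: power_Suc times_complex.sel complex.sel)
      (intro conjI real_polynomial_function.intros(3,4) real_polynomial_function_diff
        real_polynomial_function_nth; simp)
qed (simp_all add: real_polynomial_function.intros(2))

text \<open>For even \<open>N\<close> only odd \<open>k\<close> contribute, so that the truncating division is exact.\<close>

definition legendre_deriv_hom :: "nat \<Rightarrow> real^3 \<Rightarrow> real" where
  "legendre_deriv_hom N p =
     (\<Sum>k<N. coeff (pderiv (legendre N)) k * (p $ 3 ^ k * (p \<bullet> p) ^ ((N - 1 - k) div 2)))"

lemma coeff_pderiv_legendre_odd:
  assumes "even N" "even k"
  shows "coeff (pderiv (legendre N)) k = 0"
  using assms by (simp add: coeff_pderiv coeff_legendre_parity)

lemma coeff_pderiv_legendre_rec: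
  "real (k + 2) * real (k + 1) * coeff (pderiv (legendre N)) (k + 2) =
     (real (k + 1) * real (k + 2) - real N * real (N + 1)) * coeff (pderiv (legendre N)) k"
  using arg_cong [OF coeff_legendre_rec [of "k + 1" N], of "\<lambda>x. real (k + 1) * x"]
  by (simp add: coeff_pderiv algebra_simps)

text \<open>The Laplacian of the k-th term has a part of degree k - 2 in z, called A below, and a
  part of degree k, called B. A of term k + 2 cancels B of term k by the coefficient recurrence of
  P'.\<close>

lemma has_laplacian_legendre_deriv_hom:
  assumes "even N"
  shows "has_laplacian (\<lambda>p. (p $ 2 * b - p $ 1 * a) * legendre_deriv_hom N p) (\<lambda>p. 0)"
proof -
  define c where "c k = coeff (pderiv (legendre N)) k" for k
  define m where "m k = (N - 1 - k) div 2" for k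
  define A where "A p k = c k * (real k * real (k - 1) * p $ 3 ^ (k - 2) * (p \<bullet> p) ^ m k)" for p :: "real^3" and k
  define B where "B p k = c k * (2 * real (m k) * (2 * real (m k) + 2 * real k + 3) * p $ 3 ^ k * (p \<bullet> p) ^ (m k - 1))"
    for p :: "real^3" and k
  have "has_laplacian (\<lambda>p. \<Sum>k<N. c k * ((p $ 2 * b - p $ 1 * a) * p $ 3 ^ k * (p \<bullet> p) ^ m k))
    (\<lambda>p. \<Sum>k<N. c k * ((p $ 2 * b - p $ 1 * a) * (real k * real (k - 1) * p $ 3 ^ (k - 2) * (p \<bullet> p) ^ m k
        + 2 * real (m k) * (2 * real (m k) + 2 * real k + 3) * p $ 3 ^ k * (p \<bullet> p) ^ (m k - 1))))"
    by (intro has_laplacian_sum has_laplacian_cmult has_laplacian_monomial) simp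
  moreover have "(\<Sum>k<N. c k * ((p $ 2 * b - p $ 1 * a) * p $ 3 ^ k * (p \<bullet> p) ^ m k)) =
    (p $ 2 * b - p $ 1 * a) * legendre_deriv_hom N p" for p :: "real^3"
    unfolding legendre_deriv_hom_def sum_distrib_left c_def m_def by (intro sum.cong) simp_all
  moreover have "(\<Sum>k<N. c k * ((p $ 2 * b - p $ 1 * a) * (real k * real (k - 1) * p $ 3 ^ (k - 2) * (p \<bullet> p) ^ m k
        + 2 * real (m k) * (2 * real (m k) + 2 * real k + 3) * p $ 3 ^ k * (p \<bullet> p) ^ (m k - 1)))) = 0"
    (is "?L = 0") for p :: "real^3"
  proof -
    have c0: "c k = 0" if "N \<le> k" for k
      using that by (simp add: c_def coeff_pderiv coeff_legendre_beyond)
    have AB: "A p (k + 2) + B p k = 0" if "k < N" for k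
    proof (cases "even k")
      case True
      then show ?thesis using assms by (simp add: A_def B_def c_def coeff_pderiv_legendre_odd)
    next
      case False
      have "even (N - 1 - k)" using False that assms by auto
      then have "2 * m k = N - 1 - k" unfolding m_def by simp
      then have mk: "2 * real (m k) = real N - 1 - real k" using that by linarith
      have mk2: "m (k + 2) = m k - 1" unfolding m_def by simp
      have "c (k + 2) * (real (k + 2) * real (k + 1)) + c k * (2 * real (m k) * (2 * real (m k) + 2 * real k + 3)) = 0"
        using coeff_pderiv_legendre_rec [of k N] unfolding mk c_def [symmetric] by (simp add: algebra_simps)
      then have "(c (k + 2) * (real (k + 2) * real (k + 1)) + c k * (2 * real (m k) * (2 * real (m k) + 2 * real k + 3)))
          * (p $ 3 ^ k * (p \<bullet> p) ^ (m k - 1)) = 0" by simp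
      then show ?thesis
        unfolding A_def B_def mk2 by (simp add: algebra_simps)
    qed
    have "?L = (p $ 2 * b - p $ 1 * a) * ((\<Sum>k<N. A p k) + (\<Sum>k<N. B p k))"
      unfolding A_def B_def sum.distrib [symmetric] sum_distrib_left
      by (intro sum.cong refl) (simp add: algebra_simps)
    \<comment> \<open>The terms added at the top vanish because P' has degree below N; the two lost
      in the index shift that follows vanish by the factor k (k - 1).\<close>
    also have "(\<Sum>k<N. A p k) = (\<Sum>k<N + 2. A p k)"
      by (simp add: A_def c0)
    also have "\<dots> = (\<Sum>k<N. A p (k + 2))"
      by (simp add: sum.lessThan_Suc_shift A_def del: sum.lessThan_Suc)
    also have "\<dots> + (\<Sum>k<N. B p k) = 0"
      unfolding sum.distrib [symmetric] using AB by (intro sum.neutral) auto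
    finally show ?thesis by simp
  qed
  ultimately show ?thesis by simp
qed

text \<open>The factor t on the left is the one that y cos \<alpha> - x sin \<alpha> supplies under
  scaling; it avoids the truncated exponent N - 1.\<close>

lemma legendre_deriv_hom_scaleR:
  assumes "even N"
  shows "t * legendre_deriv_hom N (t *\<^sub>R p) = t ^ N * legendre_deriv_hom N p"
proof -
  have "t * (coeff (pderiv (legendre N)) k * ((t *\<^sub>R p) $ 3 ^ k * ((t *\<^sub>R p) \<bullet> (t *\<^sub>R p)) ^ ((N - 1 - k) div 2))) =
     t ^ N * (coeff (pderiv (legendre N)) k * (p $ 3 ^ k * (p \<bullet> p) ^ ((N - 1 - k) div 2)))"
    if "k < N" for k
  proof (cases "even k")
    case False
    have "even (N - 1 - k)" using False that assms by auto
    then obtain m where m: "N - 1 - k = 2 * m" by (elim evenE)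
    then have "N = 1 + k + 2 * m"
      using that by simp
    then have "t ^ N = t * t ^ k * (t * t) ^ m"
      by (simp only: power_add power_mult power2_eq_square power_one_right)
    moreover have "(N - 1 - k) div 2 = m" using m by simp
    ultimately show ?thesis
      by (simp add: power_mult_distrib mult_ac)
  qed (simp add: assms coeff_pderiv_legendre_odd)
  then show ?thesis
    unfolding legendre_deriv_hom_def sum_distrib_left by (intro sum.cong) auto
qed

lemma legendre_deriv_hom_sphere:
  assumes "p \<in> sphere2"
  shows "legendre_deriv_hom N p = poly (pderiv (legendre N)) (p $ 3)"
proof -
  have "p \<bullet> p = 1" using assms by (simp add: sphere2_def norm_eq_1)
  moreover have "poly (pderiv (legendre N)) (p $ 3) = (\<Sum>k<N. coeff (pderiv (legendre N)) k * p $ 3 ^ k)"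
    unfolding poly_altdef
  proof (rule sum.mono_neutral_cong)
    fix i assume "i \<in> {..degree (pderiv (legendre N))} - {..<N}"
    then show "coeff (pderiv (legendre N)) i * p $ 3 ^ i = 0"
      by (simp add: coeff_pderiv coeff_legendre_beyond)
  qed (auto simp: coeff_eq_0)
  ultimately show ?thesis by (simp add: legendre_deriv_hom_def)
qed

lemma spherical_harmonic_harm_H: "spherical_harmonic (2 * r) (harm_H r \<alpha> \<mu>)"
  unfolding spherical_harmonic_def
proof (intro exI conjI ballI allI)
  let ?V = "\<lambda>p::real^3. (p $ 2 * cos \<alpha> - p $ 1 * sin \<alpha>) * legendre_deriv_hom (2 * r) p"
  let ?Q = "\<lambda>p. harm_W r p + \<mu> * ?V p"
  show "real_polynomial_function ?Q"
    unfolding harm_W_def legendre_deriv_hom_def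
    by (intro real_polynomial_function.intros(2-4) real_polynomial_function_diff real_polynomial_function_sum
        real_polynomial_function_complex_power [THEN conjunct2] real_polynomial_function_nth
        real_polynomial_function_power real_polynomial_function_inner_self finite_lessThan)
  have "has_laplacian ?Q (\<lambda>x. 0 + \<mu> * 0)"
    unfolding harm_W_def
    by (intro has_laplacian_add has_laplacian_cmult has_laplacian_Im_power has_laplacian_legendre_deriv_hom) simp
  then show "laplacian ?Q x = 0" for x
    using has_laplacian_imp by fastforce
  show "harm_H r \<alpha> \<mu> p = ?Q p" if "p \<in> sphere2" for p
    using that by (simp add: harm_H_def harm_V_def legendre_deriv_hom_sphere)
  show "?Q (c *\<^sub>R x) = c ^ (2 * r) * ?Q x" for c x
  proof -
    have "Complex (c * x $ 1) (c * x $ 2) = of_real c * Complex (x $ 1) (x $ 2)"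
      by (simp add: complex_eq_iff)
    then have "harm_W r (c *\<^sub>R x) = c ^ (2 * r) * harm_W r x"
      by (simp add: harm_W_def power_mult_distrib del: of_real_power flip: of_real_power)
    moreover have "?V (c *\<^sub>R x) = (x $ 2 * cos \<alpha> - x $ 1 * sin \<alpha>) * (c * legendre_deriv_hom (2 * r) (c *\<^sub>R x))"
      by (simp add: algebra_simps)
    then have "?V (c *\<^sub>R x) = c ^ (2 * r) * ?V x"
      by (simp add: legendre_deriv_hom_scaleR)
    ultimately show ?thesis by (simp only: distrib_left mult.left_commute [of \<mu>])
  qed
qed

section \<open>Level curves of separated functions\<close>

lemma interval_homeomorphism:
  fixes f :: "real \<Rightarrow> real"
  assumes "continuous_on S f" "is_interval S" "inj_on f S"
  obtains g where "homeomorphism S (f ` S) f g"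
  using assms injective_into_1d_eq_homeomorphism is_interval_path_connected by blast

text \<open>Only the shape of X is recorded: a fall from infinity to M up to the colatitude
  \<open>a\<close>, an uncontrolled middle inside the band, and the point reflection of the fall.
  \<open>meridian_profile_ex\<close> derives this shape from the critical values.\<close>

locale meridian_profile =
  fixes X :: "real \<Rightarrow> real" and a M :: real
  assumes X_cont: "continuous_on {0<..<pi} X"
    and X_odd: "\<And>t. 0 < t \<Longrightarrow> t < pi \<Longrightarrow> X (pi - t) = - X t"
    and a: "0 < a" "a < pi / 2"
    and M: "0 < M"
    and X_a: "X a = M"
    and X_dec: "\<And>s t. 0 < s \<Longrightarrow> s < t \<Longrightarrow> t \<le> a \<Longrightarrow> X t < X s"
    and X_mid: "\<And>t. a < t \<Longrightarrow> t < pi - a \<Longrightarrow> \<bar>X t\<bar> < M"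
    and X_lim: "filterlim X at_top (at_right 0)"
begin

lemma X_top:
  assumes "0 < t" "t \<le> a"
  shows "M \<le> X t"
  using X_dec [of t a] X_a assms by (cases "t = a") auto

lemma X_bottom:
  assumes "pi - a \<le> t" "t < pi"
  shows "X t \<le> - M"
  using X_top [of "pi - t"] X_odd [of t] assms a by simp

lemma X_dec_bottom:
  assumes "pi - a \<le> s" "s < t" "t < pi"
  shows "X t < X s"
  using X_dec [of "pi - t" "pi - s"] X_odd [of t] X_odd [of s] assms a by simp

lemma X_ge:
  assumes "0 < t" "t \<le> pi - a"
  shows "- M \<le> X t"
proof -
  consider "t \<le> a" | "a < t" "t < pi - a" | "t = pi - a" using assms by linarith
  then show ?thesis
    using X_top [of t] X_mid [of t] X_odd [of a] X_a assms M a by cases auto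
qed

lemma X_unbounded:
  assumes "0 < b"
  obtains t where "0 < t" "t < b" "C < X t"
proof -
  have "eventually (\<lambda>t. C < X t) (at_right 0)"
    using X_lim filterlim_at_top_dense by blast
  moreover have "eventually (\<lambda>t. t \<in> {0<..<b}) (at_right 0)"
    using assms by (rule eventually_at_right_real)
  ultimately have "eventually (\<lambda>t. 0 < t \<and> t < b \<and> C < X t) (at_right 0)"
    by eventually_elim auto
  then show ?thesis
    using that eventually_happens [of _ "at_right (0::real)"] trivial_limit_at_right_real by blast
qed

section \<open>Replacing the uncontrolled middle of the profile\<close>

definition straightened :: "real \<Rightarrow> real" where
  "straightened t = (if a < t \<and> t < pi - a then M * (pi / 2 - t) / (pi / 2 - a) else X t)"

lemma straightened_outer: "t \<le> a \<or> pi - a \<le> t \<Longrightarrow> straightened t = X t"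
  by (auto simp: straightened_def)

lemma straightened_inner:
  assumes "a \<le> t" "t \<le> pi - a"
  shows "straightened t = M * (pi / 2 - t) / (pi / 2 - a)"
proof -
  consider "t = a" | "a < t" "t < pi - a" | "t = pi - a" using assms by linarith
  then show ?thesis
  proof cases
    case 3
    have "M * (pi / 2 - t) / (pi / 2 - a) = - M"
      unfolding 3 by (subst divide_eq_eq) (use a in \<open>simp add: algebra_simps\<close>)
    then show ?thesis using 3 X_a X_odd [of a] a by (simp add: straightened_def)
  qed (use X_a a in \<open>auto simp: straightened_def\<close>)
qed

lemma straightened_decreasing:
  assumes "0 < s" "s < t" "t < pi"
  shows "straightened t < straightened s"
proof -
  have inner: "straightened t < straightened s" if "a \<le> s" "s < t" "t \<le> pi - a" for s t
    using that a M by (simp add: straightened_inner divide_strict_right_mono)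
  have outer1: "straightened t < straightened s" if "0 < s" "s < t" "t \<le> a" for s t
    using that X_dec by (simp add: straightened_outer)
  have outer2: "straightened t < straightened s" if "pi - a \<le> s" "s < t" "t < pi" for s t
    using that X_dec_bottom by (simp add: straightened_outer)
  consider "t \<le> a" | "s < a" "a < t" "t \<le> pi - a" | "s < a" "pi - a < t"
    | "a \<le> s" "t \<le> pi - a" | "a \<le> s" "s < pi - a" "pi - a < t" | "pi - a \<le> s"
    using assms by linarith
  then show ?thesis
  proof cases
    case 2 then show ?thesis using outer1 [of s a] inner [of a t] assms by simp
  next
    case 3 then show ?thesis
      using outer1 [of s a] inner [of a "pi - a"] outer2 [of "pi - a" t] assms a by simp
  next
    case 5 then show ?thesis using inner [of s "pi - a"] outer2 [of "pi - a" t] assms by simp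
  qed (use assms inner outer1 outer2 in auto)
qed

lemma straightened_cont: "continuous_on {0<..<pi} straightened"
proof -
  \<comment> \<open>Clamped arguments merge the three pieces into one continuous formula: outside
    its own piece each summand is constant, and the constants M and - M cancel.\<close>
  let ?g = "\<lambda>t. X (min t a) + M * (pi / 2 - max a (min t (pi - a))) / (pi / 2 - a) + X (max t (pi - a))"
  have "continuous_on {0<..<pi} ?g"
    by (intro continuous_on_add continuous_on_compose2 [OF X_cont] continuous_intros)
      (use a in \<open>auto simp: min_def max_def\<close>)
  moreover have "?g t = straightened t" if "t \<in> {0<..<pi}" for t
  proof -
    have ends: "M * (pi / 2 - a) / (pi / 2 - a) = M" "M * (pi / 2 - (pi - a)) / (pi / 2 - a) = - M"
      "X (pi - a) = - M"
      using straightened_inner [of a] straightened_inner [of "pi - a"] straightened_outer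
        X_a X_odd [of a] a by simp_all
    consider "t \<le> a" | "a \<le> t" "t \<le> pi - a" | "pi - a \<le> t" by linarith
    then show ?thesis
    proof cases
      case 1
      then have "min t a = t" "max a (min t (pi - a)) = a" "max t (pi - a) = pi - a"
        using a by auto
      then show ?thesis using 1 ends by (simp add: straightened_outer)
    next
      case 2
      then have "min t a = a" "max a (min t (pi - a)) = t" "max t (pi - a) = pi - a"
        using a by auto
      then show ?thesis using 2 ends X_a by (simp add: straightened_inner)
    next
      case 3
      then have "min t a = a" "max a (min t (pi - a)) = pi - a" "max t (pi - a) = t"
        using a by auto
      then show ?thesis using 3 ends X_a by (simp add: straightened_outer)
    qed
  qed
  ultimately show ?thesis by (rule continuous_on_eq)
qed

lemma straightened_image: "straightened ` {0<..<pi} = UNIV"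
proof -
  have "y \<in> straightened ` {0<..<pi}" for y
  proof -
    obtain s where s: "0 < s" "s < a" "\<bar>y\<bar> < X s" using X_unbounded [of a "\<bar>y\<bar>"] a by auto
    have "straightened s = X s" "straightened (pi - s) = - X s"
      using s X_odd [of s] a by (simp_all add: straightened_outer)
    moreover have "continuous_on {s..pi - s} straightened"
      using s by (intro continuous_on_subset [OF straightened_cont]) auto
    ultimately obtain t where "s \<le> t" "t \<le> pi - s" "straightened t = y"
      using IVT2' [of straightened "pi - s" y s] s a by force
    then show ?thesis using s by auto
  qed
  then show ?thesis by auto
qed

lemma straightened_inj: "inj_on straightened {0<..<pi}"
  by (rule linorder_inj_onI) (use straightened_decreasing in \<open>force+\<close>)

lemma ex_straight_inverse:
  obtains T where "continuous_on UNIV T" "\<And>y. 0 < T y \<and> T y < pi"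
    "\<And>y. straightened (T y) = y" "\<And>t. 0 < t \<Longrightarrow> t < pi \<Longrightarrow> T (straightened t) = t"
proof -
  obtain T where "homeomorphism {0<..<pi} (straightened ` {0<..<pi}) straightened T"
    using interval_homeomorphism straightened_cont straightened_inj is_interval_oo by metis
  then have T: "homeomorphism {0<..<pi} UNIV straightened T" by (simp only: straightened_image)
  show ?thesis
  proof
    show "continuous_on UNIV T" using T homeomorphism_cont2 by blast
    show "0 < T y \<and> T y < pi" for y
      using homeomorphism_image2 [OF T] by (metis UNIV_I greaterThanLessThan_iff image_eqI)
    show "straightened (T y) = y" for y using homeomorphism_apply2 [OF T] by blast
    show "T (straightened t) = t" if "0 < t" "t < pi" for t
      using homeomorphism_apply1 [OF T] that by simp
  qed
qed

lemma straightened_large: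
  assumes "0 < t" "t < pi"
  shows "M \<le> \<bar>straightened t\<bar> \<longleftrightarrow> \<not> (a < t \<and> t < pi - a)"
    and "M \<le> \<bar>X t\<bar> \<longleftrightarrow> \<not> (a < t \<and> t < pi - a)"
proof -
  have "\<bar>straightened t\<bar> < M" if "a < t" "t < pi - a"
  proof -
    have "straightened (pi - a) < straightened t" "straightened t < straightened a"
      using that a by (auto intro: straightened_decreasing)
    then show ?thesis using X_a X_odd [of a] a by (simp add: straightened_outer)
  qed
  moreover have "M \<le> \<bar>X t\<bar>" if "\<not> (a < t \<and> t < pi - a)"
    using that X_top [of t] X_bottom [of t] assms by linarith
  ultimately show "M \<le> \<bar>straightened t\<bar> \<longleftrightarrow> \<not> (a < t \<and> t < pi - a)"
    "M \<le> \<bar>X t\<bar> \<longleftrightarrow> \<not> (a < t \<and> t < pi - a)"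
    using X_mid [of t] straightened_outer [of t] by force+
qed

text \<open>Every point is joined to small t, where X exceeds any bound. Decreasing t at fixed u
  works if t \<le> a or if Z u lies below the band; otherwise the zigzag of X may block the way, and
  a slide at fixed t first brings Z below - M. The lemma is applied to Y and, after reflection in t,
  to - Y.\<close>

lemma superlevel_connected:
  fixes c d :: real and Z :: "real \<Rightarrow> real"
  assumes Z_cont: "continuous_on {c<..<d} Z"
    and descent: "\<And>u. c < u \<Longrightarrow> u < d \<Longrightarrow> \<bar>Z u\<bar> \<le> M \<Longrightarrow>
      \<exists>v. c < v \<and> v < d \<and> Z v < - M \<and> (\<forall>x\<in>closed_segment u v. Z x \<le> Z u)"
  shows "connected {(t, u). 0 < t \<and> t < pi \<and> c < u \<and> u < d \<and> Z u < X t}" (is "connected ?E")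
proof -
  have vertical: "connected_component ?E (t, u) (s, u)"
    if "0 < s" "s \<le> t" "t < pi" "c < u" "u < d" "\<And>x. s \<le> x \<Longrightarrow> x \<le> t \<Longrightarrow> Z u < X x" for s t u
    by (rule connected_componentI [of "{s..t} \<times> {u}"])
      (use that in \<open>auto intro!: connected_Times\<close>)
  have horizontal: "connected_component ?E (t, u) (t, v)"
    if "0 < t" "t < pi" "c < u" "u < d" "c < v" "v < d" "\<And>x. x \<in> closed_segment u v \<Longrightarrow> Z x < X t" for t u v
  proof (rule connected_componentI [of "{t} \<times> closed_segment u v"])
    show "{t} \<times> closed_segment u v \<subseteq> ?E"
      using that by (auto simp: closed_segment_eq_real_ivl split: if_splits)
  qed (auto intro!: connected_Times)
  have up_low: "connected_component ?E (t, u) (s, u)"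
    if "0 < s" "s \<le> t" "t < pi" "c < u" "u < d" "Z u < X t" "Z u < - M" for s t u
  proof (rule vertical)
    fix x assume x: "s \<le> x" "x \<le> t"
    show "Z u < X x"
    proof (cases "x \<le> pi - a")
      case True
      then show ?thesis using X_ge [of x] that x by simp
    next
      case False
      then show ?thesis using X_dec_bottom [of x t] that x by (cases "x = t") auto
    qed
  qed (use that in auto)
  \<comment> \<open>All s in (0, t] are offered, so that two points can later be compared at a
    common colatitude.\<close>
  have up: "\<exists>v. c < v \<and> v < d \<and> (\<forall>s. 0 < s \<longrightarrow> s \<le> t \<longrightarrow> connected_component ?E (t, u) (s, v))"
    if tu: "0 < t" "t < pi" "c < u" "u < d" "Z u < X t" for t u
  proof -
    consider "t \<le> a" | "Z u < - M" | "a < t" "- M \<le> Z u" by linarith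
    then show ?thesis
    proof cases
      case 1
      have "connected_component ?E (t, u) (s, u)" if s: "0 < s" "s \<le> t" for s
      proof (rule vertical)
        fix x assume "s \<le> x" "x \<le> t"
        then show "Z u < X x"
          using X_dec [of x t] \<open>Z u < X t\<close> 1 s by (cases "x = t") auto
      qed (use s tu in auto)
      then show ?thesis using tu by blast
    next
      case 2
      then show ?thesis using tu up_low by blast
    next
      case 3
      have "t < pi - a" using X_bottom [of t] 3 tu by force
      then have "\<bar>Z u\<bar> \<le> M" using X_mid [of t] 3 tu by linarith
      then obtain v where v: "c < v" "v < d" "Z v < - M" "\<forall>x\<in>closed_segment u v. Z x \<le> Z u"
        using descent tu by blast
      have "connected_component ?E (t, u) (t, v)"
        using v tu by (intro horizontal) force+
      moreover have "connected_component ?E (t, v) (s, v)" if s: "0 < s" "s \<le> t" for s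
        using v s 3 \<open>Z u < X t\<close> \<open>t < pi\<close> by (intro up_low) auto
      ultimately show ?thesis using v connected_component_trans by blast
    qed
  qed
  show ?thesis
    unfolding connected_iff_connected_component
  proof safe
    fix t u t' u'
    assume *: "0 < t" "t < pi" "c < u" "u < d" "Z u < X t" "0 < t'" "t' < pi" "c < u'" "u' < d" "Z u' < X t'"
    obtain v where v: "c < v" "v < d" "\<And>s. 0 < s \<Longrightarrow> s \<le> t \<Longrightarrow> connected_component ?E (t, u) (s, v)"
      using up [of t u] * by blast
    obtain v' where v': "c < v'" "v' < d" "\<And>s. 0 < s \<Longrightarrow> s \<le> t' \<Longrightarrow> connected_component ?E (t', u') (s, v')"
      using up [of t' u'] * by blast
    \<comment> \<open>Z is bounded on the segment from v to v', which can thus be crossed at a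
      colatitude where X exceeds the maximum of Z.\<close>
    have "continuous_on (closed_segment v v') Z"
      using v v' by (intro continuous_on_subset [OF Z_cont])
        (auto simp: closed_segment_eq_real_ivl split: if_splits)
    then obtain w where w: "\<And>x. x \<in> closed_segment v v' \<Longrightarrow> Z x \<le> Z w"
      using continuous_attains_sup [of "closed_segment v v'" Z] by auto
    obtain s where s: "0 < s" "s < min t t'" "Z w < X s"
      using X_unbounded [of "min t t'" "Z w"] * by auto
    have "connected_component ?E (s, v) (s, v')"
      using s v v' * w by (intro horizontal) (auto intro: le_less_trans)
    moreover have "connected_component ?E (t, u) (s, v)" "connected_component ?E (t', u') (s, v')"
      using v v' s by auto
    ultimately show "connected_component ?E (t, u) (t', u')"
      by (blast intro: connected_component_trans connected_component_sym)
  qed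
qed

end

section \<open>Functions with finitely many monotone branches and their level curves\<close>

lemma interval_index:
  fixes e :: "nat \<Rightarrow> 'a::linorder"
  assumes "e 0 \<le> u" "u < e n"
  shows "\<exists>k<n. e k \<le> u \<and> u < e (Suc k)"
  using assms
proof (induction n)
  case (Suc n)
  then show ?case by (cases "u < e n") (auto simp: not_less intro: less_SucI)
qed simp

text \<open>Branch k is the interval from \<open>e k\<close> to \<open>e (Suc k)\<close>; on it
  (-1)^k Y rises from below - L to above L. Since \<open>Y_out\<close> also holds at
  \<open>e n\<close>, the number n of branches is even.\<close>

locale zigzag_pair = meridian_profile X a M for X :: "real \<Rightarrow> real" and a M :: real +
  fixes Y :: "real \<Rightarrow> real" and c d L :: real and n :: nat and e :: "nat \<Rightarrow> real"
  assumes Y_cont: "continuous_on {c<..<d} Y"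
    and L: "M < L"
    and e_ends: "c < e 0" "e n < d"
    and e_less: "\<And>i j. i < j \<Longrightarrow> j \<le> n \<Longrightarrow> e i < e j"
    and Y_e: "\<And>k. k \<le> n \<Longrightarrow> (-1) ^ k * Y (e k) < - L"
    and Y_branch: "\<And>k x y. k < n \<Longrightarrow> e k \<le> x \<Longrightarrow> x < y \<Longrightarrow> y \<le> e (Suc k) \<Longrightarrow>
      (-1) ^ k * Y x < (-1) ^ k * Y y"
    and Y_out: "\<And>u. c < u \<Longrightarrow> u < d \<Longrightarrow> u \<le> e 0 \<or> e n \<le> u \<Longrightarrow> Y u < - L"
    and Y_lim: "filterlim Y at_bot (at_right c)" "filterlim Y at_bot (at_left d)"
begin

lemma e_le: "i \<le> j \<Longrightarrow> j \<le> n \<Longrightarrow> e i \<le> e j"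
  using e_less [of i j] by (cases "i = j") auto

lemma branch_subset: "k < n \<Longrightarrow> {e k..e (Suc k)} \<subseteq> {c<..<d}"
  using e_le [of 0 k] e_le [of "Suc k" n] e_ends by force

lemma branch_inj: "k < n \<Longrightarrow> inj_on Y {e k..e (Suc k)}"
  by (rule linorder_inj_onI) (use Y_branch in \<open>force+\<close>)

lemma branch_unique:
  assumes "j < n" "k < n" "e j < u" "u < e (Suc j)" "e k < u" "u < e (Suc k)"
  shows "j = k"
  using assms e_le [of "Suc j" k] e_le [of "Suc k" j]
  by (cases j k rule: linorder_cases) auto

lemma Y_e_large: "k \<le> n \<Longrightarrow> L < \<bar>Y (e k)\<bar>"
  using Y_e [of k] by (cases "even k") auto

lemma branch_ex:
  assumes "c < u" "u < d" "\<bar>Y u\<bar> \<le> L"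
  obtains k where "k < n" "e k < u" "u < e (Suc k)"
proof -
  have u: "e 0 < u" "u < e n" using Y_out [of u] assms by force+
  obtain k where k: "k < n" "e k \<le> u" "u < e (Suc k)"
    using interval_index [of e u n] u by auto
  moreover have "e k \<noteq> u" using Y_e_large [of k] k assms by auto
  ultimately show ?thesis using that by force
qed

lemma branch_image:
  assumes "k < n" "\<bar>y\<bar> \<le> L"
  shows "y \<in> Y ` {e k..e (Suc k)}"
proof -
  have "e k \<le> e (Suc k)" using e_le assms by simp
  moreover have "continuous_on {e k..e (Suc k)} Y"
    using branch_subset assms by (intro continuous_on_subset [OF Y_cont])
  moreover have "Y (e k) \<le> y \<and> y \<le> Y (e (Suc k)) \<or> Y (e (Suc k)) \<le> y \<and> y \<le> Y (e k)"
    using Y_e [of k] Y_e [of "Suc k"] assms by (cases "even k") auto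
  ultimately obtain x where "e k \<le> x" "x \<le> e (Suc k)" "Y x = y"
    using IVT' [of Y "e k" y "e (Suc k)"] IVT2' [of Y "e (Suc k)" y "e k"] by blast
  then show ?thesis by auto
qed

lemma ex_branch_inverse:
  assumes "k < n"
  obtains J where "continuous_on {- L..L} J" "\<And>y. \<bar>y\<bar> \<le> L \<Longrightarrow> e k < J y \<and> J y < e (Suc k) \<and> Y (J y) = y"
    "\<And>u. e k < u \<Longrightarrow> u < e (Suc k) \<Longrightarrow> J (Y u) = u"
proof -
  let ?B = "{e k..e (Suc k)}"
  obtain J where J: "homeomorphism ?B (Y ` ?B) Y J"
    using interval_homeomorphism [of ?B Y] branch_inj [OF assms] is_interval_cc
      continuous_on_subset [OF Y_cont branch_subset [OF assms]] by metis
  show ?thesis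
  proof
    show "continuous_on {- L..L} J"
      using homeomorphism_cont2 [OF J] by (rule continuous_on_subset) (use branch_image assms in auto)
    show "e k < J y \<and> J y < e (Suc k) \<and> Y (J y) = y" if "\<bar>y\<bar> \<le> L" for y
    proof -
      have y: "y \<in> Y ` ?B" using branch_image assms that by blast
      then have "Y (J y) = y" using homeomorphism_apply2 [OF J] by blast
      moreover have "J y \<in> ?B" using homeomorphism_image2 [OF J] y by blast
      moreover have "J y \<noteq> e k" "J y \<noteq> e (Suc k)"
        using Y_e_large [of k] Y_e_large [of "Suc k"] assms that \<open>Y (J y) = y\<close> by fastforce+
      ultimately show ?thesis by force
    qed
    show "J (Y u) = u" if "e k < u" "u < e (Suc k)" for u
      using homeomorphism_apply1 [OF J] that by simp
  qed
qed

text \<open>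
  Near a branch, a point \<open>(T (Y p), p)\<close> of the level curve of the straightened profile is moved
  along the branch to the point at which \<open>Y\<close> takes the value \<open>X (T (Y p))\<close>.
\<close>

lemma level_set_arc:
  obtains f g where "continuous_on {c<..<d} f" "continuous_on {c<..<d} g"
    "inj_on (\<lambda>p. (f p, g p)) {c<..<d}"
    "(\<lambda>p. (f p, g p)) ` {c<..<d} = {(t, u). 0 < t \<and> t < pi \<and> c < u \<and> u < d \<and> X t = Y u}"
    "(f \<longlongrightarrow> pi) (at_right c)" "(f \<longlongrightarrow> pi) (at_left d)"
proof -
  obtain T where T: "continuous_on UNIV T" "\<And>y. 0 < T y \<and> T y < pi"
    "\<And>y. straightened (T y) = y" "\<And>t. 0 < t \<Longrightarrow> t < pi \<Longrightarrow> T (straightened t) = t"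
    using ex_straight_inverse by blast
  have "\<forall>k. \<exists>J. k < n \<longrightarrow> continuous_on {- L..L} J \<and>
      (\<forall>y. \<bar>y\<bar> \<le> L \<longrightarrow> e k < J y \<and> J y < e (Suc k) \<and> Y (J y) = y) \<and>
      (\<forall>u. e k < u \<longrightarrow> u < e (Suc k) \<longrightarrow> J (Y u) = u)"
    using ex_branch_inverse by metis
  then obtain J where J: "\<And>k. k < n \<Longrightarrow> continuous_on {- L..L} (J k)"
    "\<And>k y. k < n \<Longrightarrow> \<bar>y\<bar> \<le> L \<Longrightarrow> e k < J k y \<and> J k y < e (Suc k) \<and> Y (J k y) = y"
    "\<And>k u. k < n \<Longrightarrow> e k < u \<Longrightarrow> u < e (Suc k) \<Longrightarrow> J k (Y u) = u"
    by metis
  \<comment> \<open>The true value of X at the colatitude where the straightened profile has the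
    value y; outside the band this is y itself.\<close>
  define xi where "xi y = X (T y)" for y
  have xi_large: "xi y = y" if "M \<le> \<bar>y\<bar>" for y
    using straightened_large(1) [of "T y"] straightened_outer [of "T y"] T that
    by (metis linorder_not_less xi_def)
  have xi_small: "\<bar>xi y\<bar> < M" if "\<bar>y\<bar> < M" for y
    using straightened_large [of "T y"] T(2,3) [of y] that unfolding xi_def by (smt (verit))
  have xi_le: "\<bar>xi y\<bar> \<le> L" if "\<bar>y\<bar> \<le> L" for y
    using xi_large [of y] xi_small [of y] that L by linarith
  have xi_range: "xi y \<in> {- L..L}" if "- L < y" "y < L" for y
    using xi_le [of y] that by (simp add: abs_le_iff)
  have xi_cont: "continuous_on UNIV xi"
    unfolding xi_def by (rule continuous_on_compose2 [OF X_cont T(1)]) (use T in auto)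
  \<comment> \<open>Off the branches \<open>br\<close> is a default value; \<open>g\<close> consults
    it only if |Y u| < L, where a point of (c, d) lies on exactly one branch.\<close>
  define br where "br u = (THE k. k < n \<and> e k < u \<and> u < e (Suc k))" for u
  have br: "br u = k" if "k < n" "e k < u" "u < e (Suc k)" for k u
    unfolding br_def using that branch_unique by blast
  have br_ex: "br u < n \<and> e (br u) < u \<and> u < e (Suc (br u))" if "c < u" "u < d" "\<bar>Y u\<bar> \<le> L" for u
    using branch_ex [OF that] br by metis
  define f where "f u = T (Y u)" for u
  define g where "g u = (if \<bar>Y u\<bar> < L then J (br u) (xi (Y u)) else u)" for u
  have g_branch: "g u = J k (xi (Y u))" if "k < n" "e k < u" "u < e (Suc k)" "\<bar>Y u\<bar> < L" for k u
    using that br by (simp add: g_def)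
  have g_large: "g u = u" if "c < u" "u < d" "M \<le> \<bar>Y u\<bar>" for u
  proof (cases "\<bar>Y u\<bar> < L")
    case True
    then show ?thesis using br_ex [of u] that xi_large J(3) by (simp add: g_def)
  qed (simp add: g_def)
  \<comment> \<open>The last conjunct is the level equation along the curve, since xi (Y u) = X (f
    u).\<close>
  have Yg: "c < g u \<and> g u < d \<and> Y (g u) = xi (Y u)" if "c < u" "u < d" for u
  proof (cases "\<bar>Y u\<bar> < L")
    case True
    then have "br u < n" using br_ex that by auto
    then have "e (br u) < g u \<and> g u < e (Suc (br u)) \<and> Y (g u) = xi (Y u)"
      using J(2) [of "br u" "xi (Y u)"] xi_le [of "Y u"] True by (simp add: g_def)
    then show ?thesis using subsetD [OF branch_subset [OF \<open>br u < n\<close>], of "g u"] by auto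
  next
    case False
    then show ?thesis using that xi_large [of "Y u"] L by (simp add: g_def)
  qed
  show ?thesis
  proof
    show f_cont: "continuous_on {c<..<d} f"
      unfolding f_def by (rule continuous_on_compose2 [OF T(1) Y_cont]) auto
    \<comment> \<open>Gluing: \<open>g\<close> is a branch inverse composed with \<open>xi\<close>
      on each \<open>U k\<close> and the identity on \<open>V\<close>. Because M < L these open sets
      cover the interval.\<close>
    define U where "U k = {e k<..<e (Suc k)} \<inter> Y -` {-L<..<L}" for k
    define V where "V = {c<..<d} \<inter> Y -` (- {-M..M})"
    have U: "open (U k)" "continuous_on (U k) g" if "k < n" for k
    proof -
      have Yk: "continuous_on {e k<..<e (Suc k)} Y"
        by (rule continuous_on_subset [OF Y_cont]) (rule order_trans [OF greaterThanLessThan_subseteq_atLeastAtMost_iff [THEN iffD2] branch_subset [OF that]], simp)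
      show "open (U k)"
        unfolding U_def using Yk by (rule continuous_open_preimage) auto
      have "continuous_on (U k) (\<lambda>u. J k (xi (Y u)))"
        by (intro continuous_on_compose2 [OF J(1)] continuous_on_compose2 [OF xi_cont]
            continuous_on_subset [OF Yk] that) (use xi_range in \<open>auto simp: U_def\<close>)
      then show "continuous_on (U k) g"
        by (rule continuous_on_eq) (use g_branch that in \<open>auto simp: U_def\<close>)
    qed
    have V: "open V" "continuous_on V g"
    proof -
      show "open V" unfolding V_def by (rule continuous_open_preimage [OF Y_cont]) auto
      show "continuous_on V g"
        by (rule continuous_on_eq [OF continuous_on_id]) (use g_large in \<open>force simp: V_def\<close>)
    qed
    have "continuous_on (\<Union>k\<in>{..<n}. U k) g"
      by (rule continuous_on_open_UN) (use U in auto)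
    then have "continuous_on ((\<Union>k\<in>{..<n}. U k) \<union> V) g"
      using U V by (intro continuous_on_open_Un) auto
    moreover have "{c<..<d} \<subseteq> (\<Union>k\<in>{..<n}. U k) \<union> V"
    proof
      fix u assume u: "u \<in> {c<..<d}"
      show "u \<in> (\<Union>k\<in>{..<n}. U k) \<union> V"
      proof (cases "\<bar>Y u\<bar> < L")
        case True
        then show ?thesis using br_ex [of u] u unfolding U_def by force
      next
        case False
        then show ?thesis using u L by (force simp: V_def)
      qed
    qed
    ultimately show "continuous_on {c<..<d} g" by (rule continuous_on_subset)
    show "inj_on (\<lambda>p. (f p, g p)) {c<..<d}"
    proof (rule inj_onI)
      fix u v assume uv: "u \<in> {c<..<d}" "v \<in> {c<..<d}" "(f u, g u) = (f v, g v)"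
      \<comment> \<open>The first coordinate determines Y u; inside the levels - L and L the second
        determines the branch of u, and a branch together with a value of Y determines the
        point.\<close>
      then have Y: "Y u = Y v" using T(3) unfolding f_def by (metis Pair_inject)
      show "u = v"
      proof (cases "\<bar>Y u\<bar> < L")
        case True
        have bu: "br u < n \<and> e (br u) < u \<and> u < e (Suc (br u))" using br_ex True uv by auto
        have bv: "br v < n \<and> e (br v) < v \<and> v < e (Suc (br v))" using br_ex True uv Y by auto
        have "J (br u) (xi (Y u)) = J (br v) (xi (Y u))" using uv True Y by (simp add: g_def)
        then have "br u = br v"
          using J(2) [of "br u" "xi (Y u)"] J(2) [of "br v" "xi (Y u)"] bu bv xi_le [of "Y u"] True
            branch_unique [of "br u" "br v" "J (br u) (xi (Y u))"] by auto
        then show ?thesis using J(3) bu bv Y by metis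
      qed (use uv Y in \<open>simp add: g_def\<close>)
    qed
    show "(\<lambda>p. (f p, g p)) ` {c<..<d} = {(t, u). 0 < t \<and> t < pi \<and> c < u \<and> u < d \<and> X t = Y u}"
    proof (intro subset_antisym subsetI)
      fix q assume "q \<in> (\<lambda>p. (f p, g p)) ` {c<..<d}"
      then show "q \<in> {(t, u). 0 < t \<and> t < pi \<and> c < u \<and> u < d \<and> X t = Y u}"
        using T(2) Yg by (auto simp: f_def xi_def)
    next
      fix q assume "q \<in> {(t, u). 0 < t \<and> t < pi \<and> c < u \<and> u < d \<and> X t = Y u}"
      then obtain t u where q: "q = (t, u)" "0 < t" "t < pi" "c < u" "u < d" "X t = Y u" by blast
      show "q \<in> (\<lambda>p. (f p, g p)) ` {c<..<d}"
      proof (cases "M \<le> \<bar>Y u\<bar>")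
        case True
        then have "straightened t = Y u"
          using straightened_large [of t] straightened_outer [of t] q by force
        then have "f u = t" unfolding f_def using T(4) q by metis
        then show ?thesis using g_large [of u] True q by force
      next
        case False
        then have k: "br u < n \<and> e (br u) < u \<and> u < e (Suc (br u))" using br_ex q L by auto
        \<comment> \<open>The preimage lies on the same branch, where Y takes the straightened value
          in place of X t.\<close>
        define v where "v = J (br u) (straightened t)"
        have st: "\<bar>straightened t\<bar> < M"
          using straightened_large [of t] q False by linarith
        then have v: "e (br u) < v" "v < e (Suc (br u))" "Y v = straightened t"
          using J(2) [of "br u" "straightened t"] k L by (auto simp: v_def)
        have "f v = t" using v T(4) q by (simp add: f_def)
        moreover have "g v = u"
          using g_branch [of "br u" v] v k st L J(3) [of "br u" u] T(4) [of t] q by (simp add: xi_def)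
        moreover have "v \<in> {c<..<d}" using v subsetD [OF branch_subset [of "br u"], of v] k by auto
        ultimately show ?thesis using q by blast
      qed
    qed
    have lim: "(f \<longlongrightarrow> pi) F" if "filterlim Y at_bot F" for F
    proof (rule order_tendstoI)
      fix b assume b: "b < pi"
      \<comment> \<open>The maximum with pi / 2 keeps the comparison point inside (0, pi).\<close>
      define b' where "b' = max b (pi / 2)"
      have b': "0 < b'" "b' < pi" "b \<le> b'" using b by (auto simp: b'_def less_max_iff_disj)
      have "eventually (\<lambda>u. Y u < straightened b') F"
        using that filterlim_at_bot_dense by blast
      then show "eventually (\<lambda>u. b < f u) F"
      proof eventually_elim
        case (elim u)
        have "\<not> T (Y u) \<le> b'"
          using straightened_decreasing [of "T (Y u)" b'] T(2,3) [of "Y u"] elim b' by force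
        then show ?case using b' by (simp add: f_def)
      qed
    next
      fix b assume "pi < b"
      then show "eventually (\<lambda>u. f u < b) F"
        using T(2) less_trans by (intro always_eventually) (auto simp: f_def)
    qed
    show "(f \<longlongrightarrow> pi) (at_right c)" "(f \<longlongrightarrow> pi) (at_left d)"
      using lim Y_lim by blast+
  qed
qed

text \<open>Such a point is interior to a monotone branch. One end of the branch lies below - M and
  the other above M; the parity of k decides which.\<close>

lemma Y_descent:
  assumes "c < u" "u < d" "\<bar>Y u\<bar> \<le> M"
  shows "\<exists>v. c < v \<and> v < d \<and> Y v < - M \<and> (\<forall>x\<in>closed_segment u v. Y x \<le> Y u)"
    and "\<exists>v. c < v \<and> v < d \<and> M < Y v \<and> (\<forall>x\<in>closed_segment u v. Y u \<le> Y x)"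
proof -
  obtain k where k: "k < n" "e k < u" "u < e (Suc k)" using branch_ex [of u] assms L by auto
  have bounds: "c < e k" "e k < d" "c < e (Suc k)" "e (Suc k) < d"
    using subsetD [OF branch_subset [OF k(1)], of "e k"] subsetD [OF branch_subset [OF k(1)], of "e (Suc k)"] k
    by auto
  have left: "(-1) ^ k * Y x \<le> (-1) ^ k * Y u" if "x \<in> closed_segment u (e k)" for x
    using Y_branch [of k x u] that k by (cases "x = u") (auto simp: closed_segment_eq_real_ivl)
  have right: "(-1) ^ k * Y u \<le> (-1) ^ k * Y x" if "x \<in> closed_segment u (e (Suc k))" for x
    using Y_branch [of k u x] that k by (cases "x = u") (auto simp: closed_segment_eq_real_ivl)
  have ends: "(-1) ^ k * Y (e k) < - M" "M < (-1) ^ k * Y (e (Suc k))"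
    using Y_e [of k] Y_e [of "Suc k"] k L by auto
  show "\<exists>v. c < v \<and> v < d \<and> Y v < - M \<and> (\<forall>x\<in>closed_segment u v. Y x \<le> Y u)"
    using bounds left right ends by (cases "even k") (auto intro: exI [of _ "e k"] exI [of _ "e (Suc k)"])
  show "\<exists>v. c < v \<and> v < d \<and> M < Y v \<and> (\<forall>x\<in>closed_segment u v. Y u \<le> Y x)"
    using bounds left right ends by (cases "even k") (auto intro: exI [of _ "e k"] exI [of _ "e (Suc k)"])
qed

lemma above_connected: "connected {(t, u). 0 < t \<and> t < pi \<and> c < u \<and> u < d \<and> Y u < X t}"
  using Y_cont Y_descent(1) by (rule superlevel_connected)

text \<open>The reflection t -> pi - t changes the sign of X and so turns X < Y into - Y <
  X.\<close>

lemma below_connected: "connected {(t, u). 0 < t \<and> t < pi \<and> c < u \<and> u < d \<and> X t < Y u}"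
proof -
  let ?A = "{(t, u). 0 < t \<and> t < pi \<and> c < u \<and> u < d \<and> - Y u < X t}"
  have "connected ?A"
    using Y_descent(2) by (intro superlevel_connected continuous_on_minus Y_cont) (simp add: abs_le_iff)
  then have "connected ((\<lambda>(t, u). (pi - t, u)) ` ?A)"
    by (rule connected_continuous_image [rotated]) (auto intro!: continuous_intros simp: case_prod_beta)
  moreover have "(\<lambda>(t, u). (pi - t, u)) ` ?A = {(t, u). 0 < t \<and> t < pi \<and> c < u \<and> u < d \<and> X t < Y u}"
  proof (intro subset_antisym subsetI)
    fix q assume "q \<in> {(t, u). 0 < t \<and> t < pi \<and> c < u \<and> u < d \<and> X t < Y u}"
    then obtain t u where q: "q = (t, u)" "0 < t" "t < pi" "c < u" "u < d" "X t < Y u" by blast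
    then have "(pi - t, u) \<in> ?A" using X_odd [of t] by auto
    then show "q \<in> (\<lambda>(t, u). (pi - t, u)) ` ?A" using q by (force intro: image_eqI [of _ _ "(pi - t, u)"])
  qed (auto simp: X_odd)
  ultimately show ?thesis by simp
qed

end

section \<open>Closing an open arc whose two ends converge to the same point\<close>

lemma simple_closed_curve_of_arc:
  fixes h :: "real \<Rightarrow> real^3"
  assumes "c < d" "continuous_on {c<..<d} h" "inj_on h {c<..<d}" "q \<notin> h ` {c<..<d}"
    and lim: "(h \<longlongrightarrow> q) (at_right c)" "(h \<longlongrightarrow> q) (at_left d)"
  obtains \<gamma> where "simple_closed_curve \<gamma>" "path_image \<gamma> = insert q (h ` {c<..<d})"
proof -
  define H where "H u = (if c < u \<and> u < d then h u else q)" for u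
  define l where "l t = c + (d - c) * t" for t
  have cont: "continuous_on {c..d} H"
  proof (rule continuous_on_IccI)
    have "eventually (\<lambda>u. h u = H u) (at_right c)" "eventually (\<lambda>u. h u = H u) (at_left d)"
      using eventually_at_right_real [OF assms(1)] eventually_at_left_real [OF assms(1)]
      by (auto elim!: eventually_mono simp: H_def)
    then show "(H \<longlongrightarrow> H c) (at_right c)" "(H \<longlongrightarrow> H d) (at_left d)"
      using Lim_transform_eventually [OF lim(1)] Lim_transform_eventually [OF lim(2)]
      by (simp_all add: H_def [of c] H_def [of d])
    show "H \<midarrow>x\<rightarrow> H x" if x: "c < x" "x < d" for x
    proof -
      have "continuous_on {c<..<d} H"
        by (rule continuous_on_eq [OF assms(2)]) (simp add: H_def)
      then show ?thesis using x by (simp add: continuous_on_eq_continuous_at isCont_def)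
    qed
  qed (use assms in simp)
  have l_image: "l ` {0..1} = {c..d}"
    using assms(1) image_affinity_atLeastAtMost [of "d - c" c 0 1] unfolding l_def
    by (simp add: add.commute)
  have l_inj: "l s = l t \<longleftrightarrow> s = t" for s t using assms(1) by (simp add: l_def)
  have l_range: "c < l t \<and> l t < d \<longleftrightarrow> 0 < t \<and> t < 1" for t
  proof -
    have "(d - c) * t < d - c \<longleftrightarrow> t < 1" "0 < (d - c) * t \<longleftrightarrow> 0 < t"
      using assms(1) mult_less_cancel_left_pos [of "d - c" t 1] by (simp_all add: zero_less_mult_iff)
    then show ?thesis unfolding l_def by linarith
  qed
  have H_l: "H (l t) = (if 0 < t \<and> t < 1 then h (l t) else q)" for t
    using l_range [of t] by (simp only: H_def)
  have img: "path_image (H \<circ> l) = insert q (h ` {c<..<d})"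
    unfolding path_image_def image_comp [symmetric] l_image using assms(1) by (force simp: H_def)
  have "path (H \<circ> l)"
    unfolding path_def
    by (rule continuous_on_compose) (simp_all only: l_image cont, simp add: l_def continuous_intros)
  moreover have "loop_free (H \<circ> l)"
    unfolding loop_free_def
  proof (intro ballI impI)
    fix s t :: real assume st: "s \<in> {0..1}" "t \<in> {0..1}" "(H \<circ> l) s = (H \<circ> l) t"
    consider "0 < s" "s < 1" "0 < t" "t < 1" | "0 < s" "s < 1" "\<not> (0 < t \<and> t < 1)"
      | "\<not> (0 < s \<and> s < 1)" "0 < t" "t < 1" | "\<not> (0 < s \<and> s < 1)" "\<not> (0 < t \<and> t < 1)" by blast
    then show "s = t \<or> s = 0 \<and> t = 1 \<or> s = 1 \<and> t = 0"
    proof cases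
      case 1
      then have "h (l s) = h (l t)" "l s \<in> {c<..<d}" "l t \<in> {c<..<d}"
        using st(3) l_range by (simp_all add: H_l)
      then show ?thesis using inj_onD [OF assms(3)] l_inj by blast
    next
      case 2
      then have "h (l s) = q" "l s \<in> {c<..<d}" using st(3) l_range by (simp_all only: H_l comp_apply if_True if_False) auto
      then show ?thesis using assms(4) by blast
    next
      case 3
      then have "q = h (l t)" "l t \<in> {c<..<d}" using st(3) l_range by (simp_all only: H_l comp_apply if_True if_False) auto
      then show ?thesis using assms(4) by blast
    next
      case 4
      then show ?thesis using st by auto
    qed
  qed
  moreover have "pathfinish (H \<circ> l) = pathstart (H \<circ> l)"
    by (simp add: pathfinish_def pathstart_def H_def l_def)
  ultimately show ?thesis
    using that img by (auto simp: simple_closed_curve_def simple_path_def)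
qed

text \<open>\<open>a\<close> is the first colatitude with X = M. Before it X > M, so there is no
  critical point and Rolle's theorem makes X decreasing. From \<open>a\<close> to pi / 2 the end
  values are M and 0, and an extremum at an interior point is critical, so |X| stays below
  M.\<close>

lemma meridian_profile_ex:
  fixes X X' :: "real \<Rightarrow> real"
  assumes deriv: "\<And>t. 0 < t \<Longrightarrow> t < pi \<Longrightarrow> (X has_real_derivative X' t) (at t)"
    and odd: "\<And>t. 0 < t \<Longrightarrow> t < pi \<Longrightarrow> X (pi - t) = - X t"
    and lim: "filterlim X at_top (at_right 0)"
    and M: "0 < M"
    and crit: "\<And>t. 0 < t \<Longrightarrow> t < pi / 2 \<Longrightarrow> X' t = 0 \<Longrightarrow> \<bar>X t\<bar> < M"
  shows "\<exists>a. meridian_profile X a M"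
proof -
  have cont: "continuous_on {0<..<pi} X"
    using DERIV_isCont [OF deriv] by (intro continuous_at_imp_continuous_on) auto
  have mid: "X (pi / 2) = 0" using odd [of "pi / 2"] by simp
  have mid_eq: "X z = 0" if "z = pi / 2" for z using mid by (simp only: that)
  have near: "\<exists>s. 0 < s \<and> s < b \<and> (\<forall>t. 0 < t \<longrightarrow> t \<le> s \<longrightarrow> C < X t)" if "0 < b" for b C
  proof -
    have "eventually (\<lambda>t. C < X t) (at_right 0)"
      using lim filterlim_at_top_dense by blast
    then obtain s where "0 < s" "\<And>t. 0 < t \<Longrightarrow> t < s \<Longrightarrow> C < X t"
      unfolding eventually_at_right_field by blast
    then show ?thesis using that by (intro exI [of _ "min s b / 2"]) auto
  qed
  obtain s where s: "0 < s" "s < pi / 2" "\<And>t. 0 < t \<Longrightarrow> t \<le> s \<Longrightarrow> M < X t"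
    using near [of "pi / 2" M] by auto
  have cont_s: "continuous_on {u..v} X" if "0 < u" "v < pi" for u v
    using that by (intro continuous_on_subset [OF cont]) auto
  \<comment> \<open>Up to s the function exceeds M, so the bound s loses no solution and makes the
    solution set compact.\<close>
  have "compact ({s..pi / 2} \<inter> X -` {M})"
    using s by (intro compact_eq_bounded_closed [THEN iffD2] conjI continuous_closed_preimage cont_s
        bounded_subset [OF bounded_closed_interval]) auto
  moreover have "{s..pi / 2} \<inter> X -` {M} \<noteq> {}"
    using IVT2' [of X "pi / 2" M s] cont_s [of s "pi / 2"] s(3) [of s] s mid M by fastforce
  ultimately obtain a where a: "a \<in> {s..pi / 2} \<inter> X -` {M}"
      "\<And>t. t \<in> {s..pi / 2} \<inter> X -` {M} \<Longrightarrow> a \<le> t"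
    using compact_attains_inf [of "{s..pi / 2} \<inter> X -` {M}"] by blast
  have a': "0 < a" "X a = M" "s \<le> a" "a < pi / 2"
  proof -
    show 1: "0 < a" "X a = M" "s \<le> a" using a(1) s by auto
    have "a \<noteq> pi / 2"
    proof
      assume "a = pi / 2"
      then have "X a = 0" by (simp only: mid)
      then show False using 1(2) M by simp
    qed
    then show "a < pi / 2" using a(1) by simp
  qed
  have above: "M < X t" if t: "0 < t" "t < a" for t
  proof (rule ccontr)
    assume "\<not> M < X t"
    then have "s < t" using s(3) [of t] t by force
    then obtain u where "s \<le> u" "u \<le> t" "X u = M"
      using IVT2' [of X t M s] cont_s [of s t] s(1,2) s(3) [of s] t a' \<open>\<not> M < X t\<close> by force
    then show False using a(2) [of u] t a' by auto
  qed
  have dec: "X t < X s" if st: "0 < s" "s < t" "t \<le> a" for s t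
  proof (rule ccontr)
    assume "\<not> X t < X s"
    \<comment> \<open>X is large near 0, so if it did not fall from s to t, the value X t would be
      taken a second time at some v \<le> s.\<close>
    obtain w where w: "0 < w" "w < s" "X t < X w" using near [of s "X t"] st by force
    obtain v where v: "w \<le> v" "v \<le> s" "X v = X t"
      using IVT2' [of X s "X t" w] cont_s [of w s] w st a' \<open>\<not> X t < X s\<close> by force
    have "\<exists>z. v < z \<and> z < t \<and> (X has_real_derivative 0) (at z)"
    proof (rule Rolle)
      show "X differentiable (at z)" if "v < z" "z < t" for z
        using deriv [of z] v w st a' that by (auto simp: real_differentiable_def)
    qed (use v w st a' cont_s [of v t] in auto)
    then obtain z where z: "v < z" "z < t" "(X has_real_derivative 0) (at z)" by blast
    have bnd: "0 < z" "z < a" "z < pi / 2" using z v w st a' by auto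
    then have "X' z = 0" using deriv [of z] z DERIV_unique by fastforce
    then show False using crit [of z] above [of z] bnd M by auto
  qed
  have half: "\<bar>X t\<bar> < M" if t: "a < t" "t < pi / 2" for t
  proof -
    have ne: "{a..pi / 2} \<noteq> {}" "compact {a..pi / 2}" using a' by auto
    have c: "continuous_on {a..pi / 2} X" using a' by (intro cont_s) auto
    have crit_value: "\<bar>X z\<bar> < M" if z: "a < z" "z < pi / 2"
      and ext: "(\<forall>x\<in>{a..pi / 2}. X x \<le> X z) \<or> (\<forall>x\<in>{a..pi / 2}. X z \<le> X x)" for z
    proof -
      define \<delta> where "\<delta> = min (z - a) (pi / 2 - z)"
      have \<delta>: "0 < \<delta>" "\<And>y. \<bar>z - y\<bar> < \<delta> \<Longrightarrow> y \<in> {a..pi / 2}" using z by (auto simp: \<delta>_def)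
      have "(X has_real_derivative X' z) (at z)" using deriv z a' by auto
      then have "X' z = 0"
        using ext \<delta> DERIV_local_max [of X "X' z" z \<delta>] DERIV_local_min [of X "X' z" z \<delta>] by blast
      then show ?thesis using crit [of z] z a' by auto
    qed
    obtain p where p: "p \<in> {a..pi / 2}" "\<forall>x\<in>{a..pi / 2}. X x \<le> X p"
      using continuous_attains_sup [OF ne(2,1) c] by blast
    obtain q where q: "q \<in> {a..pi / 2}" "\<forall>x\<in>{a..pi / 2}. X q \<le> X x"
      using continuous_attains_inf [OF ne(2,1) c] by blast
    have "X t < M"
    proof (rule ccontr)
      assume "\<not> X t < M"
      moreover have "X p < M \<or> p = a"
        using crit_value [of p] p mid_eq [of p] M by (cases "p = pi / 2"; cases "p = a") force+
      moreover have "X t \<le> X p" using p t by simp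
      ultimately have "p = a" by linarith
      \<comment> \<open>With X t at least the maximum M, the interior point t is itself a maximum
        and hence critical.\<close>
      then have "\<forall>x\<in>{a..pi / 2}. X x \<le> X t" using p a' \<open>\<not> X t < M\<close> by force
      then show False using crit_value [of t] t \<open>\<not> X t < M\<close> by auto
    qed
    moreover have "- M < X t"
    proof (rule ccontr)
      assume "\<not> - M < X t"
      moreover have "X q \<le> X t" using q t by simp
      ultimately have "X q \<le> - M" by linarith
      then have "q \<noteq> a" "q \<noteq> pi / 2" using a' mid_eq [of q] M by auto
      then show False using crit_value [of q] q \<open>X q \<le> - M\<close> by auto
    qed
    ultimately show ?thesis by linarith
  qed
  have "meridian_profile X a M"
  proof
    show "\<bar>X t\<bar> < M" if "a < t" "t < pi - a" for t
    proof -
      consider "t < pi / 2" | "t = pi / 2" | "pi / 2 < t" by linarith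
      then show ?thesis
      proof cases
        case 3
        then show ?thesis using half [of "pi - t"] odd [of t] that a' by auto
      qed (use half that mid_eq [of t] M in auto)
    qed
  qed (use cont odd a' M dec lim in auto)
  then show ?thesis by blast
qed

section \<open>The two profiles\<close>

locale small_perturbation =
  fixes r :: nat and \<alpha> \<mu> :: real
  assumes r: "1 \<le> r"
    and \<alpha>: "0 < \<alpha>" "2 * real r * \<alpha> < pi / 2"
    and \<mu>: "0 < \<mu>" "ereal \<mu> < mu_c r \<alpha>"
begin

abbreviation P where "P \<equiv> legendre (2 * r)"
abbreviation P' where "P' \<equiv> pderiv (legendre (2 * r))"

definition X :: "real \<Rightarrow> real" where
  "X t = \<mu> * poly P' (cos t) / sin t ^ (2 * r - 1)"

definition Y :: "real \<Rightarrow> real" where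
  "Y u = - sin (real (2 * r) * u) / sin (u - \<alpha>)"

definition f :: "real \<Rightarrow> real" where
  "f u = real (2 * r) * cos (real (2 * r) * u) * sin (u - \<alpha>) - sin (real (2 * r) * u) * cos (u - \<alpha>)"

definition g :: "real poly" where
  "g = smult (real (2 * r)) P - [:0, 1:] * P'"

lemma n\<alpha>: "0 < real (2 * r) * \<alpha>" "real (2 * r) * \<alpha> < pi / 2" "real (2 * r) * \<alpha> < pi"
proof -
  show "0 < real (2 * r) * \<alpha>" using \<alpha>(1) r by (intro mult_pos_pos) auto
  show "real (2 * r) * \<alpha> < pi / 2" using \<alpha>(2) by (simp only: of_nat_mult of_nat_numeral)
  then show "real (2 * r) * \<alpha> < pi" using pi_gt_zero by linarith
qed

lemma \<alpha>_less: "\<alpha> < pi / real (2 * r)" "\<alpha> < pi / 2"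
proof -
  show "\<alpha> < pi / real (2 * r)" using n\<alpha> r by (simp add: field_simps)
  have "1 * \<alpha> \<le> real (2 * r) * \<alpha>" using r \<alpha> by (intro mult_right_mono) auto
  then show "\<alpha> < pi / 2" using n\<alpha> by linarith
qed

lemma sin_n\<alpha>: "0 < sin (real (2 * r) * \<alpha>)"
  using n\<alpha> by (intro sin_gt_zero)

text \<open>Multiplying numerator and denominator by a power of sin t produces the term (1 - cos^2
  t) P'', which Legendre's equation expresses by P and P'.\<close>

lemma X_deriv:
  assumes "0 < t" "t < pi"
  shows "(X has_real_derivative \<mu> * (real (2 * r) + 1) * poly g (cos t) / sin t ^ (2 * r)) (at t)"
proof -
  define s where "s = sin t"
  have s: "s \<noteq> 0" using assms sin_gt_zero [of t] by (simp add: s_def)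
  \<comment> \<open>With 2r = m + 2 the truncated exponent 2r - 1 becomes m + 1.\<close>
  obtain m where m: "2 * r = m + 2" using r by (metis add.commute le_add_diff_inverse mult_2 add_le_mono one_add_one)
  have ode: "s\<^sup>2 * poly (pderiv P') (cos t) = 2 * cos t * poly P' (cos t) - (m + 2) * (m + 3) * poly P (cos t)"
    using legendre_ode [of "cos t" "2 * r"] unfolding m s_def
    by (simp add: sin_squared_eq algebra_simps)
  have "(X has_real_derivative
      (\<mu> * (poly (pderiv P') (cos t) * - s) * s ^ (m + 1) - \<mu> * poly P' (cos t) * (real (m + 1) * s ^ m * cos t))
       / (s ^ (m + 1) * s ^ (m + 1))) (at t)"
  proof -
    have "((\<lambda>t. \<mu> * poly P' (cos t)) has_real_derivative \<mu> * (poly (pderiv P') (cos t) * - s)) (at t)"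
      unfolding s_def by (intro DERIV_cmult DERIV_chain2 [OF poly_DERIV] DERIV_cos)
    moreover have "((\<lambda>t. sin t ^ (m + 1)) has_real_derivative real (m + 1) * s ^ m * cos t) (at t)"
      unfolding s_def by (auto intro!: derivative_eq_intros simp del: power_Suc)
    ultimately show ?thesis
      using DERIV_divide [of _ _ t UNIV "\<lambda>t. sin t ^ (m + 1)"] s unfolding X_def m s_def by force
  qed
  moreover have "(\<mu> * (poly (pderiv P') (cos t) * - s) * s ^ (m + 1) - \<mu> * poly P' (cos t) * (real (m + 1) * s ^ m * cos t))
       / (s ^ (m + 1) * s ^ (m + 1)) =
      - \<mu> * (s\<^sup>2 * poly (pderiv P') (cos t) + real (m + 1) * cos t * poly P' (cos t)) / s ^ (m + 2)"
    using s by (simp add: field_simps power2_eq_square)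
  moreover have "\<dots> = \<mu> * real (m + 3) * (real (m + 2) * poly P (cos t) - cos t * poly P' (cos t)) / s ^ (m + 2)"
    unfolding ode by (simp add: algebra_simps)
  moreover have "\<dots> = \<mu> * (real (2 * r) + 1) * poly g (cos t) / sin t ^ (2 * r)"
    by (simp add: g_def m s_def)
  ultimately show ?thesis by simp
qed

lemma X_odd: "X (pi - t) = - X t"
  by (simp add: X_def poly_pderiv_legendre_minus)

lemma X_lim: "filterlim X at_top (at_right 0)"
proof -
  have "((\<lambda>t. \<mu> * poly P' (cos t)) \<longlongrightarrow> \<mu> * poly P' (cos 0)) (at_right 0)"
    by (intro tendsto_intros)
  moreover have "0 < \<mu> * poly P' (cos 0)"
    using r \<mu> by (simp add: poly_pderiv_legendre_1)
  moreover have "filterlim (\<lambda>t::real. inverse (sin t ^ (2 * r - 1))) at_top (at_right 0)"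
  proof (rule filterlim_inverse_at_top)
    have "((\<lambda>t::real. sin t ^ (2 * r - 1)) \<longlongrightarrow> sin 0 ^ (2 * r - 1)) (at_right 0)"
      by (intro tendsto_intros)
    then show "((\<lambda>t::real. sin t ^ (2 * r - 1)) \<longlongrightarrow> 0) (at_right 0)"
      using r by (simp add: power_0_left)
    show "eventually (\<lambda>t::real. 0 < sin t ^ (2 * r - 1)) (at_right 0)"
      using eventually_at_right_real [OF pi_gt_zero] by eventually_elim (simp add: sin_gt_zero)
  qed
  ultimately show ?thesis
    unfolding X_def divide_inverse by (rule filterlim_tendsto_pos_mult_at_top)
qed

lemma poly_g_0: "poly g 0 \<noteq> 0"
  using r poly_legendre_0_nonzero [of "2 * r"] by (simp add: g_def)

lemma poly_g_minus: "poly g (- t) = poly g t"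
  by (simp add: g_def poly_legendre_minus poly_pderiv_legendre_minus)

text \<open>The coefficient of t^k in \<open>g\<close> is 2r - k times that of P, which disposes of
  k = 2r; odd k vanish by parity.\<close>

lemma degree_g: "degree g \<le> 2 * (r - 1)"
proof (rule degree_le, intro allI impI)
  fix k assume k: "2 * (r - 1) < k"
  have "coeff g k = (real (2 * r) - real k) * coeff P k"
    by (cases k) (simp_all add: g_def coeff_pderiv algebra_simps)
  moreover consider "k = 2 * r" | "odd k" | "2 * r < k" using k r by (cases "k = 2 * r - 1") force+
  then have "real (2 * r) - real k = 0 \<or> coeff P k = 0"
    by cases (simp_all add: coeff_legendre_parity coeff_legendre_beyond)
  ultimately show "coeff g k = 0" by simp
qed

lemma omega_ex:
  assumes "0 < w" "w < pi / 2" "poly g (cos w) = 0"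
  obtains i where "i \<in> {1..r - 1}" "omega r i = w"
proof -
  define S where "S = {w. 0 < w \<and> w < pi / 2 \<and> poly g (cos w) = 0}"
  have S_eq: "S = {\<omega>. 0 < \<omega> \<and> \<omega> < pi / 2 \<and>
            real (2 * r) * poly P (cos \<omega>) - cos \<omega> * poly P' (cos \<omega>) = 0}"
    by (simp add: S_def g_def)
  have g0: "g \<noteq> 0" using poly_g_0 by auto
  have inj: "inj_on cos S" by (rule inj_onI) (auto simp: S_def intro: cos_inj_pi)
  have pos: "0 < cos w" if "w \<in> S" for w using that by (auto simp: S_def intro: cos_gt_zero)
  have roots: "cos ` S \<union> uminus ` cos ` S \<subseteq> {x. poly g x = 0}"
    by (auto simp: S_def poly_g_minus)
  have fin: "finite (cos ` S)"
    using poly_roots_finite [OF g0] roots by (meson finite_subset le_sup_iff)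
  then have finS: "finite S" using inj finite_imageD by blast
  have "card (cos ` S \<union> uminus ` cos ` S) = card S + card S"
  proof (subst card_Un_disjoint)
    show "cos ` S \<inter> uminus ` cos ` S = {}"
    proof (rule equals0I)
      fix x assume "x \<in> cos ` S \<inter> uminus ` cos ` S"
      then obtain w w' where "w \<in> S" "w' \<in> S" "cos w = - cos w'" by auto
      then show False using pos [of w] pos [of w'] by simp
    qed
    have "card (uminus ` cos ` S) = card (cos ` S)" by (rule card_image) simp
    then show "card (cos ` S) + card (uminus ` cos ` S) = card S + card S"
      using card_image [OF inj] by simp
  qed (use fin in auto)
  moreover have "card (cos ` S \<union> uminus ` cos ` S) \<le> 2 * (r - 1)"
    using card_mono [OF poly_roots_finite [OF g0] roots] card_poly_roots_bound [OF g0] degree_g by linarith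
  ultimately have card: "card S \<le> r - 1" by simp
  have "w \<in> set (sorted_list_of_set S)" using finS assms by (simp add: S_def)
  then obtain k where k: "k < length (sorted_list_of_set S)" "sorted_list_of_set S ! k = w"
    by (auto simp: in_set_conv_nth)
  then have "omega r (Suc k) = w" by (simp add: omega_def S_eq)
  moreover have "Suc k \<in> {1..r - 1}" using k card by simp
  ultimately show ?thesis using that by blast
qed

section \<open>Zeros and signs of \<open>f\<close>, which govern the monotonicity of Y\<close>

abbreviation N where "N \<equiv> real (2 * r)"

lemma N: "2 \<le> N" using r by simp

lemma N_sq: "1 < N\<^sup>2"
proof (rule one_less_power)
  show "1 < N" using N by linarith
qed simp

lemma sin_cos_N_plus_pi: "sin (N * (u + pi)) = sin (N * u)" "cos (N * (u + pi)) = cos (N * u)"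
proof -
  have "N * (u + pi) = N * u + real r * (2 * pi)" by (simp add: algebra_simps)
  moreover have "sin (x + real r * (2 * pi)) = sin x" "cos (x + real r * (2 * pi)) = cos x" for x
    by (simp_all add: sin_add cos_add sin_2npi cos_2npi mult.assoc [symmetric] mult.commute [of _ 2])
  ultimately show "sin (N * (u + pi)) = sin (N * u)" "cos (N * (u + pi)) = cos (N * u)"
    by (simp_all only:)
qed

lemma grid_lower: "1 \<le> j \<Longrightarrow> \<alpha> < real j * pi / N"
proof -
  assume "1 \<le> j"
  then have "1 * pi / N \<le> real j * pi / N" by (intro divide_right_mono mult_right_mono) auto
  then show ?thesis using \<alpha>_less(1) by simp
qed

lemma grid_upper: "j \<le> 2 * r \<Longrightarrow> real j * pi / N \<le> pi"
proof -
  assume "j \<le> 2 * r"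
  then have "real j * pi / N \<le> N * pi / N" by (intro divide_right_mono mult_right_mono) auto
  then show ?thesis using N by simp
qed

lemma sin_sign:
  assumes "real j * pi / N < u" "u < real (Suc j) * pi / N"
  shows "0 < (-1) ^ j * sin (N * u)"
proof -
  have "real j * pi < N * u" "N * u < real j * pi + pi"
    using assms N by (simp_all add: field_simps)
  then have "0 < sin (N * u - real j * pi)" by (intro sin_gt_zero) auto
  then show ?thesis by (simp add: sin_diff mult.commute del: of_nat_mult)
qed

text \<open>The two products of cosines cancel. Hence f is monotone between consecutive zeros of sin
  (N u) as long as sin (u - \<alpha>) keeps its sign.\<close>

lemma f_deriv: "(f has_real_derivative (1 - N\<^sup>2) * sin (N * u) * sin (u - \<alpha>)) (at u)"
proof -
  define n where "n = N"
  show ?thesis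
    unfolding f_def n_def [symmetric]
    by (rule derivative_eq_intros refl)+ (simp add: algebra_simps power2_eq_square)
qed

lemma f_cont: "continuous_on A f"
  using DERIV_isCont [OF f_deriv] by (simp add: continuous_at_imp_continuous_on)

lemma f_decreasing:
  assumes "1 \<le> j" "j < 2 * r" "real j * pi / N \<le> x" "x < y" "y \<le> real (Suc j) * pi / N"
  shows "(-1) ^ j * f y < (-1) ^ j * f x"
proof (rule DERIV_neg_imp_decreasing_open [OF assms(4)])
  fix u assume u: "x < u" "u < y"
  have "0 < (-1) ^ j * sin (N * u)" using sin_sign [of j u] assms u by simp
  moreover have "0 < sin (u - \<alpha>)"
    using grid_lower [OF assms(1)] grid_upper [of "Suc j"] assms u \<alpha> by (intro sin_gt_zero) auto
  ultimately have "0 < ((-1) ^ j * sin (N * u)) * sin (u - \<alpha>)" by (rule mult_pos_pos)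
  moreover have "1 - N\<^sup>2 < 0" using N_sq by linarith
  ultimately have "(1 - N\<^sup>2) * (((-1) ^ j * sin (N * u)) * sin (u - \<alpha>)) < 0"
    by (rule mult_neg_pos [rotated])
  moreover have "((\<lambda>u. (-1) ^ j * f u) has_real_derivative (-1) ^ j * ((1 - N\<^sup>2) * sin (N * u) * sin (u - \<alpha>))) (at u)"
    by (intro DERIV_cmult f_deriv)
  ultimately show "\<exists>y. ((\<lambda>u. (-1) ^ j * f u) has_real_derivative y) (at u) \<and> y < 0"
    by (intro exI [of _ "(-1) ^ j * ((1 - N\<^sup>2) * sin (N * u) * sin (u - \<alpha>))"]) (simp add: mult_ac)
qed (intro continuous_intros f_cont)

lemma f_grid: "f (real j * pi / N) = N * ((-1) ^ j * sin (real j * pi / N - \<alpha>))"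
proof -
  have "N * (real j * pi / N) = real j * pi" using N by (simp del: of_nat_mult)
  then show ?thesis unfolding f_def by (simp del: of_nat_mult)
qed

lemma grid_step: "real j * pi / N < real (Suc j) * pi / N"
  using N by (intro divide_strict_right_mono) auto

lemma f_grid_signs:
  assumes "1 \<le> j" "j < 2 * r"
  shows "0 < (-1) ^ j * f (real j * pi / N)" "(-1) ^ j * f (real (Suc j) * pi / N) < 0"
proof -
  have pos: "0 < sin (real k * pi / N - \<alpha>)" if "1 \<le> k" "k \<le> 2 * r" for k
    using grid_lower [OF that(1)] grid_upper [OF that(2)] \<alpha> by (intro sin_gt_zero) auto
  have sq: "(-1) ^ j * ((-1) ^ j * x) = x" for x :: real
    by (cases "even j") auto
  have "(-1) ^ j * f (real j * pi / N) = N * sin (real j * pi / N - \<alpha>)"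
    unfolding f_grid mult.left_commute [of _ N] sq ..
  then show "0 < (-1) ^ j * f (real j * pi / N)" using pos [of j] assms N by simp
  have "(-1) ^ Suc j * ((-1) ^ j * x) = - x" for x :: real
    using sq [of x] by simp
  then have "(-1) ^ j * f (real (Suc j) * pi / N) = - (N * sin (real (Suc j) * pi / N - \<alpha>))"
    unfolding f_grid mult.left_commute [of _ N] mult.left_commute [of "(-1) ^ j" "(-1) ^ Suc j"] by (simp only: mult_minus_right)
  moreover have "0 < N * sin (real (Suc j) * pi / N - \<alpha>)"
    using pos [of "Suc j"] assms N by (intro mult_pos_pos) auto
  ultimately show "(-1) ^ j * f (real (Suc j) * pi / N) < 0" by linarith
qed

text \<open>f changes sign over the grid cell and is strictly monotone on it, so the definite
  description in \<open>phi\<close> denotes its only zero there.\<close>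

lemma phi_props:
  assumes "1 \<le> j" "j < 2 * r"
  shows "real j * pi / N < phi r \<alpha> j" "phi r \<alpha> j < real (Suc j) * pi / N" "f (phi r \<alpha> j) = 0"
proof -
  let ?Q = "\<lambda>u. real j * pi / N < u \<and> u < real (Suc j) * pi / N \<and> f u = 0"
  have "\<exists>u\<ge>real j * pi / N. u \<le> real (Suc j) * pi / N \<and> (-1) ^ j * f u = 0"
    by (rule IVT2') (use f_grid_signs [OF assms] grid_step [of j] in
        \<open>auto intro!: continuous_intros f_cont simp: less_imp_le simp del: of_nat_mult of_nat_Suc\<close>)
  then obtain u where u: "real j * pi / N \<le> u" "u \<le> real (Suc j) * pi / N" "f u = 0" by auto
  have "u \<noteq> real j * pi / N" "u \<noteq> real (Suc j) * pi / N" using f_grid_signs [OF assms] u by auto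
  then have "?Q u" using u by linarith
  moreover have "v = u" if "?Q v" for v
    using f_decreasing [OF assms, of u v] f_decreasing [OF assms, of v u] that \<open>?Q u\<close>
    by (cases u v rule: linorder_cases) auto
  ultimately have "?Q (THE u. ?Q u)" by (rule theI)
  moreover have "phi r \<alpha> j = (THE u. ?Q u)"
    by (simp add: phi_def f_def add.commute)
  ultimately show "real j * pi / N < phi r \<alpha> j" "phi r \<alpha> j < real (Suc j) * pi / N" "f (phi r \<alpha> j) = 0"
    by metis+
qed

lemma f_sign_grid:
  assumes "1 \<le> j" "j < 2 * r" "real j * pi / N \<le> u" "u \<le> real (Suc j) * pi / N"
  shows "u < phi r \<alpha> j \<Longrightarrow> 0 < (-1) ^ j * f u" "phi r \<alpha> j < u \<Longrightarrow> (-1) ^ j * f u < 0"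
  using f_decreasing [OF assms(1,2), of u "phi r \<alpha> j"] f_decreasing [OF assms(1,2), of "phi r \<alpha> j" u]
    phi_props [OF assms(1,2)] assms by auto

text \<open>In this cell sin (N u) is positive and sin (u - \<alpha>) changes sign at \<alpha>. So f
  has its maximum at \<alpha>, with the value - sin (N \<alpha>) < 0.\<close>

lemma f_neg_near_0:
  assumes "0 \<le> u" "u \<le> pi / N"
  shows "f u < 0"
proof -
  have f\<alpha>: "f \<alpha> < 0" using sin_n\<alpha> by (simp add: f_def)
  have sin_pos: "0 < sin (N * x)" if "0 < x" "x < pi / N" for x
    using sin_sign [of 0 x] that by simp
  show ?thesis
  proof (cases u \<alpha> rule: linorder_cases)
    case less
    have "f u < f \<alpha>"
    proof (rule DERIV_pos_imp_increasing_open [OF less])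
      fix x assume x: "u < x" "x < \<alpha>"
      have "0 < sin (\<alpha> - x)" using x assms \<alpha>_less by (intro sin_gt_zero) auto
      then have "sin (x - \<alpha>) < 0" using sin_minus [of "\<alpha> - x"] by simp
      moreover have "(1 - N\<^sup>2) * sin (N * x) < 0"
        using sin_pos [of x] x assms \<alpha>_less N_sq by (intro mult_neg_pos) auto
      ultimately show "\<exists>y. (f has_real_derivative y) (at x) \<and> 0 < y"
        using f_deriv mult_neg_neg by blast
    qed (rule f_cont)
    then show ?thesis using f\<alpha> by simp
  next
    case greater
    have "f u < f \<alpha>"
    proof (rule DERIV_neg_imp_decreasing_open [OF greater])
      fix x assume x: "\<alpha> < x" "x < u"
      have "0 < sin (x - \<alpha>)"
        using x assms \<alpha> grid_upper [of 1] r by (intro sin_gt_zero) auto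
      moreover have "(1 - N\<^sup>2) * sin (N * x) < 0"
        using sin_pos [of x] x assms \<alpha> N_sq by (intro mult_neg_pos) auto
      ultimately show "\<exists>y. (f has_real_derivative y) (at x) \<and> y < 0"
        using f_deriv mult_neg_pos by blast
    qed (rule f_cont)
    then show ?thesis using f\<alpha> by simp
  qed (use f\<alpha> in simp)
qed

lemma f_plus_pi: "f (u + pi) = - f u"
proof -
  have "u + pi - \<alpha> = u - \<alpha> + pi" by simp
  then show ?thesis
    unfolding f_def by (simp only: sin_periodic_pi cos_periodic_pi sin_cos_N_plus_pi)
qed

text \<open>The inner nodes are the zeros of \<open>f\<close>; the outer two are the ends of the
  lune, added so that the node intervals fill it.\<close>

definition node :: "nat \<Rightarrow> real" where
  "node k = (if k = 0 then \<alpha> else if k = 2 * r then \<alpha> + pi else phi r \<alpha> k)"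

text \<open>The interval between two nodes meets two neighbouring grid cells, and the sign is read
  off in each. The last interval extends beyond pi, where f u = - f (u - pi) leads back to
  [0, \<alpha>].\<close>

lemma f_sign:
  assumes "k < 2 * r" "node k < u" "u < node (Suc k)"
  shows "0 < (-1) ^ Suc k * f u"
proof (cases "u \<le> real (Suc k) * pi / N")
  case True
  show ?thesis
  proof (cases "k = 0")
    case True
    then show ?thesis
      using f_neg_near_0 [of u] assms \<open>u \<le> _\<close> \<alpha> by (simp add: node_def)
  next
    case False
    then have "phi r \<alpha> k < u" "1 \<le> k" using assms by (auto simp: node_def)
    then show ?thesis
      using f_sign_grid(2) [of k u] phi_props(1) [of k] \<open>u \<le> _\<close> assms by simp
  qed
next
  case False
  show ?thesis
  proof (cases "Suc k = 2 * r")
    case True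
    have "pi < u" "u < pi + \<alpha>"
      using False assms r unfolding True by (auto simp: node_def)
    then have "f (u - pi) < 0" using \<alpha>_less by (intro f_neg_near_0) auto
    then show ?thesis using f_plus_pi [of "u - pi"] unfolding True by simp
  next
    case False
    then have "u < phi r \<alpha> (Suc k)" using assms by (simp add: node_def)
    then show ?thesis
      using f_sign_grid(1) [of "Suc k" u] phi_props(2) [of "Suc k"] \<open>\<not> u \<le> _\<close> assms False by simp
  qed
qed

lemma f_zero:
  assumes "\<alpha> < u" "u < \<alpha> + pi" "f u = 0"
  obtains j where "1 \<le> j" "j < 2 * r" "u = phi r \<alpha> j"
proof -
  obtain k where k: "k < 2 * r" "node k \<le> u" "u < node (Suc k)"
    using interval_index [of node u "2 * r"] assms r by (auto simp: node_def)
  then have "u = node k" using f_sign [of k u] assms by fastforce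
  then show ?thesis using that [of k] k assms by (auto simp: node_def split: if_splits)
qed

lemma sin_pos: "\<alpha> < u \<Longrightarrow> u < \<alpha> + pi \<Longrightarrow> 0 < sin (u - \<alpha>)"
  by (intro sin_gt_zero) auto

lemma Y_deriv:
  assumes "\<alpha> < u" "u < \<alpha> + pi"
  shows "(Y has_real_derivative - f u / (sin (u - \<alpha>))\<^sup>2) (at u)"
proof -
  define n where "n = N"
  show ?thesis
    unfolding f_def Y_def n_def [symmetric]
    by (rule derivative_eq_intros refl)+
      (use sin_pos [OF assms] in \<open>simp_all add: algebra_simps power2_eq_square\<close>)
qed

text \<open>The denominator tends to 0 from above and the numerator to - sin (N a) < 0. The filter
  is kept abstract to serve both ends of the lune.\<close>

lemma Y_lim:
  assumes F: "eventually (\<lambda>u. 0 < sin (u - \<alpha>)) F" "((\<lambda>u. u) \<longlongrightarrow> a) F"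
    and a: "sin (a - \<alpha>) = 0" "0 < sin (N * a)"
  shows "filterlim Y at_bot F"
proof -
  have "filterlim (\<lambda>u. inverse (sin (u - \<alpha>))) at_top F"
  proof (rule filterlim_inverse_at_top)
    have "((\<lambda>u. sin (u - \<alpha>)) \<longlongrightarrow> sin (a - \<alpha>)) F" by (intro tendsto_intros F)
    then show "((\<lambda>u. sin (u - \<alpha>)) \<longlongrightarrow> 0) F" by (simp only: a)
  qed (rule F)
  moreover have "((\<lambda>u. - sin (N * u)) \<longlongrightarrow> - sin (N * a)) F" by (intro tendsto_intros F)
  ultimately show ?thesis
    unfolding Y_def divide_inverse using a by (intro filterlim_tendsto_neg_mult_at_bot) auto
qed

lemma Y_lim_ends: "filterlim Y at_bot (at_right \<alpha>)" "filterlim Y at_bot (at_left (\<alpha> + pi))"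
proof -
  have "eventually (\<lambda>u. 0 < sin (u - \<alpha>)) (at_right \<alpha>)"
    using eventually_at_right_real [of \<alpha> "\<alpha> + pi"] by (auto elim!: eventually_mono intro: sin_pos)
  then show "filterlim Y at_bot (at_right \<alpha>)"
    by (rule Y_lim [where a = \<alpha>]) (use sin_n\<alpha> in \<open>simp_all only: tendsto_ident_at, simp_all\<close>)
  have "eventually (\<lambda>u. 0 < sin (u - \<alpha>)) (at_left (\<alpha> + pi))"
    using eventually_at_left_real [of \<alpha> "\<alpha> + pi"] by (auto elim!: eventually_mono intro: sin_pos)
  then show "filterlim Y at_bot (at_left (\<alpha> + pi))"
    by (rule Y_lim [where a = "\<alpha> + pi"])
      (use sin_n\<alpha> in \<open>simp_all only: tendsto_ident_at sin_cos_N_plus_pi, simp_all\<close>)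
qed

lemma Y_phi_sign:
  assumes "1 \<le> j" "j < 2 * r"
  shows "(-1) ^ j * Y (phi r \<alpha> j) < 0"
proof -
  have "0 < (-1) ^ j * sin (N * phi r \<alpha> j)" using phi_props [OF assms] by (intro sin_sign)
  moreover have "0 < sin (phi r \<alpha> j - \<alpha>)"
    using phi_props [OF assms] grid_lower [OF assms(1)] grid_upper [of "Suc j"] assms \<alpha>
    by (intro sin_pos) auto
  ultimately have "0 < ((-1) ^ j * sin (N * phi r \<alpha> j)) / sin (phi r \<alpha> j - \<alpha>)"
    by (rule divide_pos_pos)
  then show ?thesis by (simp add: Y_def)
qed

text \<open>The hypothesis \<mu> < mu_c with \<mu> moved into X and the quotient
  \<open>mu_ij\<close> multiplied out.\<close>

lemma critical_levels:
  assumes w: "0 < w" "w < pi / 2" "poly g (cos w) = 0" and j: "1 \<le> j" "j < 2 * r"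
  shows "\<bar>X w\<bar> < \<bar>Y (phi r \<alpha> j)\<bar>"
proof (cases "poly P' (cos w) = 0")
  \<comment> \<open>Where P' vanishes the quotient in \<open>mu_ij\<close> has the default value 0
    and cannot be multiplied out; here X w = 0.\<close>
  case True
  then show ?thesis using Y_phi_sign [OF j] by (auto simp: X_def)
next
  case False
  obtain i where i: "i \<in> {1..r - 1}" "omega r i = w" using omega_ex [OF w] by blast
  then have "(i, j) \<in> {1..r - 1} \<times> {1..2 * r - 1}" using j by auto
  then have "ereal \<mu> < ereal (mu_ij r \<alpha> i j)"
    using less_INF_D [OF \<mu>(2) [unfolded mu_c_def]] by fastforce
  moreover have "mu_ij r \<alpha> i j = sin w ^ (2 * r - 1) / \<bar>poly P' (cos w)\<bar> * \<bar>Y (phi r \<alpha> j)\<bar>"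
    using w sin_gt_zero [of w] by (simp add: mu_ij_def i Y_def abs_mult abs_divide)
  ultimately have "\<mu> < sin w ^ (2 * r - 1) / \<bar>poly P' (cos w)\<bar> * \<bar>Y (phi r \<alpha> j)\<bar>" by simp
  moreover have "0 < sin w ^ (2 * r - 1)" using w by (intro zero_less_power sin_gt_zero) auto
  moreover have "\<bar>X w\<bar> = \<mu> * \<bar>poly P' (cos w)\<bar> / sin w ^ (2 * r - 1)"
    using \<mu> \<open>0 < sin w ^ (2 * r - 1)\<close> by (simp add: X_def abs_mult)
  ultimately show ?thesis using False by (simp add: field_simps)
qed

lemma levels_ex:
  obtains M L where "0 < M" "M < L"
    "\<And>w. 0 < w \<Longrightarrow> w < pi / 2 \<Longrightarrow> poly g (cos w) = 0 \<Longrightarrow> \<bar>X w\<bar> < M"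
    "\<And>j. 1 \<le> j \<Longrightarrow> j < 2 * r \<Longrightarrow> L < \<bar>Y (phi r \<alpha> j)\<bar>"
proof -
  define S where "S = {w. 0 < w \<and> w < pi / 2 \<and> poly g (cos w) = 0}"
  \<comment> \<open>The inserted 0 keeps A nonempty when X has no critical point in (0, pi / 2), and
    makes M positive.\<close>
  define A where "A = insert 0 ((\<lambda>w. \<bar>X w\<bar>) ` S)"
  define B where "B = (\<lambda>j. \<bar>Y (phi r \<alpha> j)\<bar>) ` {1..<2 * r}"
  have "S \<subseteq> omega r ` {1..r - 1}" unfolding S_def using omega_ex by blast
  then have A: "finite A" "A \<noteq> {}" by (auto simp: A_def intro: finite_surj)
  have B: "finite B" "B \<noteq> {}" using r by (auto simp: B_def)
  have "Y (phi r \<alpha> j) \<noteq> 0" if "1 \<le> j" "j < 2 * r" for j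
    using Y_phi_sign [OF that] by auto
  then have "\<forall>x\<in>A. \<forall>y\<in>B. x < y"
    using critical_levels by (auto simp: A_def B_def S_def)
  then have lt: "Max A < Min B" using A B by simp
  have A0: "0 \<le> Max A" using A by (simp add: A_def)
  show ?thesis
  proof
    \<comment> \<open>The two levels cut the gap between the critical values into thirds.\<close>
    show "0 < (2 * Max A + Min B) / 3" "(2 * Max A + Min B) / 3 < (Max A + 2 * Min B) / 3"
      using lt A0 by (auto simp: field_simps)
    show "\<bar>X w\<bar> < (2 * Max A + Min B) / 3" if "0 < w" "w < pi / 2" "poly g (cos w) = 0" for w
    proof -
      have "\<bar>X w\<bar> \<in> A" using that by (auto simp: A_def S_def)
      then show ?thesis using Max_ge [OF A(1)] lt by fastforce
    qed
    show "(Max A + 2 * Min B) / 3 < \<bar>Y (phi r \<alpha> j)\<bar>" if "1 \<le> j" "j < 2 * r" for j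
    proof -
      have "\<bar>Y (phi r \<alpha> j)\<bar> \<in> B" using that by (auto simp: B_def)
      then show ?thesis using Min_le [OF B(1)] lt by fastforce
    qed
  qed
qed

text \<open>The second conclusion excludes a zero that is critical in both variables; it is obtained
  here because it uses the same two levels.\<close>

lemma zigzag_pair_ex:
  obtains a M L e where "zigzag_pair X a M Y \<alpha> (\<alpha> + pi) L (2 * r) e"
    "\<And>t u. 0 < t \<Longrightarrow> t < pi \<Longrightarrow> poly g (cos t) = 0 \<Longrightarrow> \<alpha> < u \<Longrightarrow> u < \<alpha> + pi \<Longrightarrow> f u = 0 \<Longrightarrow> X t \<noteq> Y u"
proof -
  obtain M L where lev: "0 < M" "M < L"
    and XM: "\<And>w. 0 < w \<Longrightarrow> w < pi / 2 \<Longrightarrow> poly g (cos w) = 0 \<Longrightarrow> \<bar>X w\<bar> < M"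
    and YL: "\<And>j. 1 \<le> j \<Longrightarrow> j < 2 * r \<Longrightarrow> L < \<bar>Y (phi r \<alpha> j)\<bar>"
    using levels_ex by blast
  have "\<exists>a. meridian_profile X a M"
  proof (rule meridian_profile_ex [OF X_deriv X_odd X_lim lev(1)])
    fix t assume t: "0 < t" "t < pi / 2" "\<mu> * (N + 1) * poly g (cos t) / sin t ^ (2 * r) = 0"
    have "0 < sin t" using t by (intro sin_gt_zero) auto
    then have "poly g (cos t) = 0" using t \<mu> N by (auto simp: add_eq_0_iff)
    then show "\<bar>X t\<bar> < M" using XM t by blast
  qed
  then obtain a where a: "meridian_profile X a M" ..
  have phi1: "\<alpha> < phi r \<alpha> 1" using phi_props(1) [of 1] grid_lower [of 1] r by simp
  have phin: "phi r \<alpha> (2 * r - 1) < \<alpha> + pi"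
  proof -
    have "1 \<le> 2 * r - 1" "2 * r - 1 < 2 * r" "Suc (2 * r - 1) = 2 * r" using r by auto
    then show ?thesis using phi_props(2) [of "2 * r - 1"] grid_upper [of "2 * r"] \<alpha> by simp
  qed
  have "eventually (\<lambda>u. Y u < - L) (at_right \<alpha>)" "eventually (\<lambda>u. Y u < - L) (at_left (\<alpha> + pi))"
    using Y_lim_ends filterlim_at_bot_dense by blast+
  then obtain b b' where b: "\<alpha> < b" "\<And>u. \<alpha> < u \<Longrightarrow> u < b \<Longrightarrow> Y u < - L"
    "b' < \<alpha> + pi" "\<And>u. b' < u \<Longrightarrow> u < \<alpha> + pi \<Longrightarrow> Y u < - L"
    unfolding eventually_at_right_field eventually_at_left_field by blast
  \<comment> \<open>The end nodes lie so close to the ends of the lune that Y is already below - L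
    from there outwards, and no zero of \<open>f\<close> is passed.\<close>
  define l where "l = (\<alpha> + min b (phi r \<alpha> 1)) / 2"
  define l' where "l' = (\<alpha> + pi + max b' (phi r \<alpha> (2 * r - 1))) / 2"
  have l: "\<alpha> < l" "l < b" "l < phi r \<alpha> 1" using b(1) phi1 by (auto simp: l_def min_def field_simps)
  have l': "l' < \<alpha> + pi" "b' < l'" "phi r \<alpha> (2 * r - 1) < l'" using b(3) phin by (auto simp: l'_def max_def field_simps)
  define e where "e k = (if k = 0 then l else if k = 2 * r then l' else phi r \<alpha> k)" for k
  have node_e: "node k \<le> e k" "e (Suc k) \<le> node (Suc k)" if "k < 2 * r" for k
    using that l l' by (auto simp: node_def e_def)
  have step: "e k < e (Suc k)" if k: "k < 2 * r" for k
  proof -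
    consider "k = 0" | "k = 2 * r - 1" "k \<noteq> 0" | "1 \<le> k" "Suc k < 2 * r" using k by linarith
    then show ?thesis
    proof cases
      case 1 then show ?thesis using l r by (auto simp: e_def)
    next
      case 2 then show ?thesis using l' r by (auto simp: e_def)
    next
      case 3
      then show ?thesis using phi_props(2) [of k] phi_props(1) [of "Suc k"] by (simp add: e_def)
    qed
  qed
  have "zigzag_pair X a M Y \<alpha> (\<alpha> + pi) L (2 * r) e"
  proof (intro zigzag_pair.intro zigzag_pair_axioms.intro)
    show "continuous_on {\<alpha><..<\<alpha> + pi} Y"
      using DERIV_isCont [OF Y_deriv] by (intro continuous_at_imp_continuous_on) auto
    show "e i < e j" if "i < j" "j \<le> 2 * r" for i j
      using that
    proof (induction j)
      case (Suc j)
      then show ?case using step [of j] by (cases "i = j") auto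
    qed simp
    show "(-1) ^ k * Y (e k) < - L" if k: "k \<le> 2 * r" for k
    proof -
      consider "k = 0" | "k = 2 * r" | "1 \<le> k" "k < 2 * r" using k by linarith
      then show ?thesis
      proof cases
        case 3
        then have "(-1) ^ k * Y (phi r \<alpha> k) = - \<bar>Y (phi r \<alpha> k)\<bar>"
          using Y_phi_sign [of k] by (cases "even k") auto
        then show ?thesis using YL [of k] 3 by (simp add: e_def)
      qed (use b l l' phin r in \<open>auto simp: e_def\<close>)
    qed
    show "(-1) ^ k * Y x < (-1) ^ k * Y y" if k: "k < 2 * r" "e k \<le> x" "x < y" "y \<le> e (Suc k)" for k x y
    proof -
      have in_range: "\<alpha> < u \<and> u < \<alpha> + pi" if "x \<le> u" "u \<le> y" for u
      proof -
        have "\<alpha> < e k" using k(1) l grid_lower [of k] phi_props(1) [of k] r by (auto simp: e_def)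
        moreover have "e (Suc k) < \<alpha> + pi"
          using k(1) l' phi_props(2) [of "Suc k"] grid_upper [of "Suc (Suc k)"] \<alpha> by (auto simp: e_def)
        ultimately show ?thesis using that k by linarith
      qed
      show ?thesis
      proof (rule DERIV_pos_imp_increasing_open [OF k(3)])
        fix u assume u: "x < u" "u < y"
        have "0 < (-1) ^ Suc k * f u" using node_e [OF k(1)] k u by (intro f_sign) auto
        moreover have "0 < sin (u - \<alpha>)" using in_range u by (intro sin_pos) auto
        ultimately have "0 < (-1) ^ k * (- f u / (sin (u - \<alpha>))\<^sup>2)" by (simp add: divide_neg_pos)
        moreover have "((\<lambda>u. (-1) ^ k * Y u) has_real_derivative (-1) ^ k * (- f u / (sin (u - \<alpha>))\<^sup>2)) (at u)"
          using in_range u by (intro DERIV_cmult Y_deriv) auto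
        ultimately show "\<exists>z. ((\<lambda>u. (-1) ^ k * Y u) has_real_derivative z) (at u) \<and> 0 < z" by blast
      next
        show "continuous_on {x..y} (\<lambda>u. (-1) ^ k * Y u)"
          using DERIV_isCont [OF Y_deriv] in_range
          by (intro continuous_intros continuous_at_imp_continuous_on) auto
      qed
    qed
  qed (use a lev l l' b Y_lim_ends r in \<open>auto simp: e_def\<close>)
  moreover have "X t \<noteq> Y u"
    if t: "0 < t" "t < pi" "poly g (cos t) = 0" and u: "\<alpha> < u" "u < \<alpha> + pi" "f u = 0" for t u
  proof -
    have "\<bar>X t\<bar> < M"
    proof -
      consider "t < pi / 2" | "t = pi / 2" | "pi / 2 < t" by linarith
      then show ?thesis
      proof cases
        case 2
        then have "cos t = 0" by (simp only: cos_pi_half)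
        then show ?thesis using t poly_g_0 by simp
      next
        case 3
        then show ?thesis using XM [of "pi - t"] t X_odd [of t] by (simp add: poly_g_minus)
      qed (use XM t in auto)
    qed
    moreover obtain j where "1 \<le> j" "j < 2 * r" "u = phi r \<alpha> j" using f_zero u by blast
    ultimately show ?thesis using YL [of j] lev by auto
  qed
  ultimately show ?thesis using that by blast
qed

end

section \<open>Spherical coordinates and curves on the sphere\<close>

text \<open>The complement of a member is the union of the others and thus open too, so a component
  that meets a member cannot leave it.\<close>

lemma components_eqI:
  assumes "\<Union>F = S" "pairwise disjnt F"
    and F: "\<And>C. C \<in> F \<Longrightarrow> connected C" "\<And>C. C \<in> F \<Longrightarrow> C \<noteq> {}"
      "\<And>C. C \<in> F \<Longrightarrow> openin (top_of_set S) C"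
  shows "components S = F"
proof -
  have comp: "connected_component_set S x = C" if C: "C \<in> F" "x \<in> C" for C x
  proof (rule subset_antisym)
    have "C \<subseteq> S" using C assms(1) by blast
    then show "C \<subseteq> connected_component_set S x"
      using C F(1) by (intro connected_component_maximal) auto
    let ?K = "connected_component_set S x"
    have "S - C = \<Union>(F - {C})"
      using assms(1,2) C by (auto simp: pairwise_def disjnt_def)
    then have S_C: "openin (top_of_set S) (S - C)"
      by (simp only:) (rule openin_Union, use F(3) in auto)
    have inter: "openin (top_of_set ?K) (?K \<inter> U)" if U: "openin (top_of_set S) U" for U
    proof -
      obtain T where "open T" "U = S \<inter> T" using U by (auto simp: openin_open)
      then have "?K \<inter> U = ?K \<inter> T" using connected_component_subset [of S x] by blast
      then show ?thesis using \<open>open T\<close> by (simp add: openin_open_Int)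
    qed
    have "?K \<inter> (S - C) = {} \<or> ?K \<inter> C = {}"
      using connected_connected_component [of S x] inter [OF S_C] inter [OF F(3) [OF C(1)]]
        connected_component_subset [of S x]
      unfolding connected_openin by blast
    moreover have "x \<in> ?K \<inter> C" using C \<open>C \<subseteq> S\<close> by auto
    ultimately show "?K \<subseteq> C" using connected_component_subset [of S x] by blast
  qed
  show ?thesis
  proof (intro subset_antisym subsetI)
    fix K assume "K \<in> components S"
    then obtain x where "x \<in> S" "K = connected_component_set S x" by (auto simp: components_def)
    then show "K \<in> F" using comp assms(1) by blast
  next
    fix C assume C: "C \<in> F"
    then obtain x where "x \<in> C" using F(2) by blast
    then show "C \<in> components S" using comp [OF C] C assms(1) by (auto simp: components_def)
  qed
qed

section \<open>The chart by colatitude and longitude and its antipodal symmetry\<close>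

lemma sph_axis: "sph t u = (sin t * cos u) *\<^sub>R axis 1 1 + (sin t * sin u) *\<^sub>R axis 2 1 + cos t *\<^sub>R axis 3 1"
  by (simp add: vec_eq_iff forall_3 sph_def axis_def)

lemma continuous_on_sph [continuous_intros]:
  fixes A :: "'a::t2_space set"
  shows "continuous_on A a \<Longrightarrow> continuous_on A b \<Longrightarrow> continuous_on A (\<lambda>x. sph (a x) (b x))"
  unfolding sph_axis by (intro continuous_intros)

lemma sph_antipode: "sph (pi - t) (u + pi) = - sph t u"
  by (simp add: vec_eq_iff forall_3 sph_def)

lemma sph_in_sphere2: "sph t u \<in> sphere2"
proof -
  have "(sin t * cos u)\<^sup>2 + (sin t * sin u)\<^sup>2 = (sin t)\<^sup>2 * ((cos u)\<^sup>2 + (sin u)\<^sup>2)"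
    by (simp only: power_mult_distrib distrib_left)
  then have "sph t u \<bullet> sph t u = 1"
    unfolding inner_self_3 by (simp add: sph_def)
  then show ?thesis by (simp add: sphere2_def norm_eq_1)
qed

lemma uminus_in_sphere2: "- p \<in> sphere2 \<longleftrightarrow> p \<in> sphere2"
  by (simp add: sphere2_def)

lemma sph_cong:
  assumes "cos (u - a) = cos (v - a)" "sin (u - a) = sin (v - a)"
  shows "sph t u = sph t v"
proof -
  have "cos ((u - a) + a) = cos ((v - a) + a)" "sin ((u - a) + a) = sin ((v - a) + a)"
    unfolding cos_add sin_add assms by simp_all
  then show ?thesis by (simp add: sph_def)
qed

lemma sph_inj:
  assumes "0 < t" "t < pi" "0 < s" "s < pi" "a < u" "u < a + pi" "a < v" "v < a + pi"
    and eq: "sph t u = sph s v"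
  shows "t = s \<and> u = v"
proof -
  have c: "cos t = cos s" "sin t * cos u = sin s * cos v" "sin t * sin u = sin s * sin v"
    using eq by (simp_all add: sph_def vec_eq_iff forall_3)
  have ts: "t = s" using cos_inj_pi [of t s] c assms by auto
  have "0 < sin t" using assms by (intro sin_gt_zero)
  then have "cos u = cos v" "sin u = sin v" using c ts by auto
  then have "cos (u - a) = cos (v - a)" by (simp add: cos_diff)
  then have "u - a = v - a" by (rule cos_inj_pi [rotated 4]) (use assms(5-8) in simp_all)
  then show ?thesis using ts by simp
qed

lemma sph_rotate_into_lune:
  assumes "0 < sin (v - a)"
  obtains u where "a < u" "u < a + pi" "sph t v = sph t u"
proof -
  obtain w where w: "0 \<le> w" "w \<le> pi" "cos (v - a) = cos w" "sin (v - a) = sin w"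
    using sincos_total_pi [of "sin (v - a)" "cos (v - a)"] assms by auto
  then have "w \<noteq> 0" "w \<noteq> pi" using assms by auto
  moreover have "sph t v = sph t (w + a)" using w by (intro sph_cong [where a = a]) auto
  ultimately show ?thesis using w that [of "w + a"] by auto
qed

text \<open>The antipodal map exchanges the two open lunes and the two meridians at longitudes a and
  a + pi. Up to sign there remain one pole, one meridian and one lune.\<close>

lemma sphere2_cases:
  assumes "p \<in> sphere2"
  obtains q where "p = q \<or> p = - q"
    "q = axis 3 1 \<or> (\<exists>t. 0 < t \<and> t < pi \<and> q = sph t a) \<or>
      (\<exists>t u. 0 < t \<and> t < pi \<and> a < u \<and> u < a + pi \<and> q = sph t u)"
proof -
  obtain t v where tv: "0 \<le> t" "t \<le> pi" "p = sph t v"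
    using assms range_sph by fastforce
  consider "t = 0" | "t = pi" | "0 < t" "t < pi" "0 < sin (v - a)"
    | "0 < t" "t < pi" "sin (v - a) < 0" | "0 < t" "t < pi" "sin (v - a) = 0"
    using tv by linarith
  then show ?thesis
  proof cases
    case 1
    then have "p = axis 3 1" using tv by (simp add: sph_axis)
    then show ?thesis by (intro that [of p]) auto
  next
    case 2
    then have "p = - axis 3 1" using tv by (simp add: sph_axis)
    then show ?thesis by (intro that [of "axis 3 1"]) auto
  next
    case 3
    obtain u where "a < u" "u < a + pi" "sph t v = sph t u"
      using sph_rotate_into_lune [OF 3(3)] by blast
    then show ?thesis using 3 tv by (intro that [OF disjI1 [OF tv(3)]]) blast
  next
    case 4
    have "v + pi - a = v - a + pi" by simp
    then have "sin (v + pi - a) = - sin (v - a)" by (simp only: sin_periodic_pi)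
    then have "0 < sin (v + pi - a)" using 4 by simp
    then obtain u where u: "a < u" "u < a + pi" "sph (pi - t) (v + pi) = sph (pi - t) u"
      using sph_rotate_into_lune by blast
    then have p_eq: "p = - sph (pi - t) u" unfolding tv(3) sph_antipode by (metis minus_minus)
    moreover have "0 < pi - t" "pi - t < pi" using 4 by auto
    ultimately show ?thesis using u by (intro that [of "sph (pi - t) u"] disjI2 [OF p_eq]) blast
  next
    case 5
    have "(cos (v - a))\<^sup>2 = 1" using sin_cos_squared_add [of "v - a"] 5 by simp
    then consider "cos (v - a) = 1" | "cos (v - a) = - 1" by (auto simp: power2_eq_1_iff)
    then show ?thesis
    proof cases
      case 1
      then have p_eq: "p = sph t a" unfolding tv(3) using 5 by (intro sph_cong [of v a a]) simp_all
      then show ?thesis using 5 by (intro that [OF disjI1 [OF p_eq]]) blast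
    next
      case 2
      then have "p = sph t (a + pi)" unfolding tv(3) using 5 by (intro sph_cong [of v a "a + pi"]) simp_all
      then have p_eq: "p = - sph (pi - t) a" using sph_antipode [of "pi - t" a] by simp
      moreover have "0 < pi - t" "pi - t < pi" using \<open>0 < t\<close> \<open>t < pi\<close> by auto
      ultimately show ?thesis by (intro that [OF disjI2 [OF p_eq]]) blast
    qed
  qed
qed

text \<open>The velocity of a curve on the sphere is tangent because |c|^2 is constant, so D
  annihilates it. This reduces critical zeros to derivatives of functions of one variable.\<close>

lemma critical_zero_along_curve:
  assumes crit: "critical_zero h p" and c: "(c has_vector_derivative v) (at t)" "c t = p"
    and on_sphere: "\<And>s. c s \<in> sphere2"
  shows "((\<lambda>s. h (c s)) has_real_derivative 0) (at t)"
proof -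
  obtain D where D: "(h has_derivative D) (at p within sphere2)" "\<And>v. v \<bullet> p = 0 \<Longrightarrow> D v = 0"
    using crit by (auto simp: critical_zero_def)
  have "((\<lambda>s. c s \<bullet> c s) has_real_derivative c t \<bullet> v + v \<bullet> c t) (at t)"
    using bounded_bilinear.has_vector_derivative [OF bounded_bilinear_inner c(1) c(1)]
    by (simp add: has_real_derivative_iff_has_vector_derivative)
  moreover have "(\<lambda>s. c s \<bullet> c s) = (\<lambda>s. 1)"
    using on_sphere by (auto simp: sphere2_def norm_eq_1)
  ultimately have "v \<bullet> p = 0" using DERIV_unique DERIV_const c(2) by (fastforce simp: inner_commute)
  then have D0: "D (x *\<^sub>R v) = 0" for x using D(2) by simp
  have "(h has_derivative D) (at (c t) within range c)"
    unfolding c(2) by (rule has_derivative_subset [OF D(1)]) (use on_sphere in auto)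
  then have "((\<lambda>s. h (c s)) has_derivative (\<lambda>x. D (x *\<^sub>R v))) (at t)"
    using c(1) unfolding has_vector_derivative_def by (rule has_derivative_in_compose [rotated])
  then show ?thesis by (simp add: D0 has_field_derivative_def lambda_zero)
qed

lemma has_vector_derivative_scaleR_const:
  "(k has_real_derivative k') (at t) \<Longrightarrow> ((\<lambda>s. k s *\<^sub>R v) has_vector_derivative k' *\<^sub>R v) (at t)"
  using has_vector_derivative_scaleR [of k k' t UNIV "\<lambda>_. v" 0] by simp

lemma has_vector_derivative_sph_theta:
  "((\<lambda>t. sph t u) has_vector_derivative
     (cos t * cos u) *\<^sub>R axis 1 1 + (cos t * sin u) *\<^sub>R axis 2 1 + (- sin t) *\<^sub>R axis 3 1) (at t)"
  unfolding sph_axis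
  by (intro has_vector_derivative_add has_vector_derivative_scaleR_const)
    (auto intro!: derivative_eq_intros simp: has_real_derivative_iff_has_vector_derivative [symmetric])

lemma has_vector_derivative_sph_phi:
  "((\<lambda>u. sph t u) has_vector_derivative
     (sin t * - sin u) *\<^sub>R axis 1 1 + (sin t * cos u) *\<^sub>R axis 2 1 + 0 *\<^sub>R axis 3 1) (at u)"
  unfolding sph_axis
  by (intro has_vector_derivative_add has_vector_derivative_scaleR_const)
    (auto intro!: derivative_eq_intros simp: has_real_derivative_iff_has_vector_derivative [symmetric])

text \<open>At a zero of F the product rule leaves only k F'. This strips the factor of X - Y in
  \<open>H_factor\<close>.\<close>

lemma DERIV_factor_zero:
  fixes k F :: "real \<Rightarrow> real"
  assumes "((\<lambda>s. k s * F s) has_real_derivative 0) (at t)" "(k has_real_derivative k') (at t)"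
    "(F has_real_derivative F') (at t)" "F t = 0" "k t \<noteq> 0"
  shows "F' = 0"
proof -
  have "((\<lambda>s. k s * F s) has_real_derivative k' * F t + F' * k t) (at t)"
    by (rule DERIV_mult [OF assms(2,3)])
  then have "k' * F t + F' * k t = 0" using assms(1) DERIV_unique by blast
  then show ?thesis using assms by simp
qed

lemma simple_closed_curve_uminus:
  assumes "simple_closed_curve \<gamma>"
  shows "simple_closed_curve (uminus \<circ> \<gamma>)" "path_image (uminus \<circ> \<gamma>) = uminus ` path_image \<gamma>"
proof -
  have "linear (uminus :: real^3 \<Rightarrow> _)" by (simp add: linear_uminus)
  then have "simple_path (uminus \<circ> \<gamma>)"
    using assms simple_path_linear_image_eq [of uminus \<gamma>] by (simp add: simple_closed_curve_def)
  then show "simple_closed_curve (uminus \<circ> \<gamma>)"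
    using assms by (simp add: simple_closed_curve_def pathstart_compose pathfinish_compose)
qed (rule path_image_compose)

section \<open>The nodal set and the nodal domains\<close>

context small_perturbation
begin

abbreviation H where "H \<equiv> harm_H r \<alpha> \<mu>"

abbreviation side :: "real^3 \<Rightarrow> real" where
  "side p \<equiv> p $ 2 * cos \<alpha> - p $ 1 * sin \<alpha>"

lemma H_sph:
  "H (sph t u) = sin t ^ (2 * r) * sin (N * u) + \<mu> * sin t * poly P' (cos t) * sin (u - \<alpha>)"
  by (simp only: harm_H_def harm_W_sph harm_V_sph mult_minus_left mult_minus_right diff_minus_eq_add mult.assoc)

lemma H_factor:
  assumes "0 < t" "t < pi" "sin (u - \<alpha>) \<noteq> 0"
  shows "H (sph t u) = sin t ^ (2 * r) * sin (u - \<alpha>) * (X t - Y u)"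
proof -
  have pow: "sin t ^ (2 * r) = sin t * sin t ^ (2 * r - 1)"
    using r by (cases "2 * r") auto
  define n k p where "n = N" and "k = sin t ^ (2 * r - 1)" and "p = poly P' (cos t)"
  have "k \<noteq> 0" using assms sin_gt_zero [of t] by (simp add: k_def)
  then show ?thesis
    using assms(3) unfolding H_sph X_def Y_def n_def [symmetric] p_def [symmetric] pow k_def [symmetric]
    by (simp add: field_simps)
qed

lemma H_sign:
  assumes "0 < t" "t < pi" "\<alpha> < u" "u < \<alpha> + pi"
  shows "H (sph t u) = 0 \<longleftrightarrow> X t = Y u" "0 < H (sph t u) \<longleftrightarrow> Y u < X t" "H (sph t u) < 0 \<longleftrightarrow> X t < Y u"
proof -
  have s: "0 < sin (u - \<alpha>)" using assms by (intro sin_pos)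
  define c where "c = sin t ^ (2 * r) * sin (u - \<alpha>)"
  have c: "0 < c" unfolding c_def
    using mult_pos_pos [OF zero_less_power [OF sin_gt_zero] s] assms by blast
  then show "H (sph t u) = 0 \<longleftrightarrow> X t = Y u" "0 < H (sph t u) \<longleftrightarrow> Y u < X t" "H (sph t u) < 0 \<longleftrightarrow> X t < Y u"
    using H_factor [OF assms(1,2), of u] s c unfolding c_def [symmetric]
    by (simp_all add: zero_less_mult_iff mult_less_0_iff)
qed

lemma H_meridian: "0 < t \<Longrightarrow> t < pi \<Longrightarrow> 0 < H (sph t \<alpha>)"
  using sin_n\<alpha> unfolding H_sph by (simp add: sin_gt_zero)

lemma H_uminus: "H (- p) = H p"
proof -
  have "Complex (- (p $ 1)) (- (p $ 2)) = - Complex (p $ 1) (p $ 2)" by (simp add: complex_eq_iff)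
  then have "harm_W r (- p) = harm_W r p"
    by (simp only: harm_W_def vector_uminus_component power_minus_even even_mult_iff even_numeral simp_thms)
  moreover have "harm_V r \<alpha> (- p) = harm_V r \<alpha> p"
    by (simp add: harm_V_def poly_pderiv_legendre_minus algebra_simps)
  ultimately show ?thesis by (simp add: harm_H_def)
qed

lemma H_pole: "H (axis 3 1) = 0"
  using H_sph [of 0 0] by (simp add: sph_axis)

lemma side_sph: "side (sph t u) = sin t * sin (u - \<alpha>)"
  by (simp add: sph_def sin_diff algebra_simps)

lemma side_lune: "0 < t \<Longrightarrow> t < pi \<Longrightarrow> \<alpha> < u \<Longrightarrow> u < \<alpha> + pi \<Longrightarrow> 0 < side (sph t u)"
  unfolding side_sph by (intro mult_pos_pos sin_gt_zero) auto

lemma lune_param: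
  assumes "p \<in> sphere2" "0 < side p"
  obtains t u where "0 < t" "t < pi" "\<alpha> < u" "u < \<alpha> + pi" "p = sph t u"
proof -
  obtain t v where tv: "0 \<le> t" "t \<le> pi" "p = sph t v"
    using assms(1) range_sph by fastforce
  then have "0 < sin t * sin (v - \<alpha>)" using assms(2) by (simp only: side_sph)
  moreover have "0 \<le> sin t" using tv by (intro sin_ge_zero)
  ultimately have "0 < sin (v - \<alpha>)" "sin t \<noteq> 0" by (auto simp: zero_less_mult_iff)
  moreover have "t \<noteq> 0" "t \<noteq> pi" using \<open>sin t \<noteq> 0\<close> by auto
  ultimately show ?thesis
    using sph_rotate_into_lune [of v \<alpha> t] tv that [of t] by (metis less_eq_real_def)
qed

lemma side_axis: "side (axis 3 1) = 0"
  by (simp add: axis_def)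

lemma H_cont: "continuous_on A H"
proof -
  have "continuous_on A (\<lambda>p. harm_W r p)"
    unfolding harm_W_def
    by (rule continuous_on_polymonial_function, unfold real_polynomial_function_eq [symmetric])
      (rule real_polynomial_function_complex_power [THEN conjunct2])
  then show ?thesis
    unfolding harm_H_def harm_V_def by (intro continuous_intros continuous_on_poly) auto
qed

text \<open>On this circle the V-term vanishes, and W has the sign of sin (2 r \<alpha>) away from
  the poles.\<close>

lemma great_circle:
  assumes "p \<in> sphere2" "side p = 0"
  shows "p = axis 3 1 \<or> p = - axis 3 1 \<or> 0 < H p \<and>
    (\<exists>t. 0 < t \<and> t < pi \<and> (p = sph t \<alpha> \<or> p = - sph t \<alpha>))"
proof -
  obtain q where q: "p = q \<or> p = - q"
    "q = axis 3 1 \<or> (\<exists>t. 0 < t \<and> t < pi \<and> q = sph t \<alpha>) \<or>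
      (\<exists>t u. 0 < t \<and> t < pi \<and> \<alpha> < u \<and> u < \<alpha> + pi \<and> q = sph t u)"
    using sphere2_cases [OF assms(1), of \<alpha>] .
  have "side q = 0" using q(1) assms(2) by auto
  from q(2) show ?thesis
  proof (elim disjE exE conjE)
    fix t u assume "0 < t" "t < pi" "\<alpha> < u" "u < \<alpha> + pi" "q = sph t u"
    then show ?thesis using side_lune [of t u] \<open>side q = 0\<close> by simp
  next
    fix t assume "0 < t" "t < pi" "q = sph t \<alpha>"
    then show ?thesis using H_meridian [of t] q(1) H_uminus [of q] by auto
  qed (use q in auto)
qed

text \<open>In the lune a critical zero would be critical for X and for Y at equal values, which the
  separated levels exclude. At the poles, where the chart degenerates, one curve with nonzero
  derivative suffices.\<close>

lemma no_critical_zero: "\<not> critical_zero H p"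
proof
  assume crit: "critical_zero H p"
  then have p: "p \<in> sphere2" "H p = 0" by (auto simp: critical_zero_def)
  obtain q where q: "p = q \<or> p = - q"
    "q = axis 3 1 \<or> (\<exists>t. 0 < t \<and> t < pi \<and> q = sph t \<alpha>) \<or>
      (\<exists>t u. 0 < t \<and> t < pi \<and> \<alpha> < u \<and> u < \<alpha> + pi \<and> q = sph t u)"
    using sphere2_cases [OF p(1), of \<alpha>] .
  \<comment> \<open>H is even, so the sign \<sigma> transfers every curve through q to one through
    p.\<close>
  then obtain \<sigma> :: real where \<sigma>: "\<sigma> = 1 \<or> \<sigma> = -1" "p = \<sigma> *\<^sub>R q"
    by (metis scaleR_one scaleR_minus_left)
  have H\<sigma>: "H (\<sigma> *\<^sub>R x) = H x" for x using \<sigma>(1) H_uminus by auto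
  have sphere: "\<sigma> *\<^sub>R sph t u \<in> sphere2" for t u
    using \<sigma>(1) sph_in_sphere2 uminus_in_sphere2 by auto
  have along: "((\<lambda>s. H (c s)) has_real_derivative 0) (at s)"
    if c: "(c has_vector_derivative v) (at s)" and q: "c s = q" and on: "\<And>s. \<exists>t u. c s = sph t u" for c v s
  proof -
    have "((\<lambda>x. \<sigma> *\<^sub>R c x) has_vector_derivative \<sigma> *\<^sub>R v) (at s)"
      using c by (rule bounded_linear.has_vector_derivative [OF bounded_linear_scaleR_right])
    then have "((\<lambda>x. H (\<sigma> *\<^sub>R c x)) has_real_derivative 0) (at s)"
      by (rule critical_zero_along_curve [OF crit]) (use \<sigma> q on sphere in \<open>metis+\<close>)
    then show ?thesis by (simp only: H\<sigma>)
  qed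
  from q(2) show False
  proof (elim disjE exE conjE)
    assume "q = axis 3 1"
    \<comment> \<open>At longitude \<alpha> + pi / 2 the factor sin (u - \<alpha>) is 1, while the
      W-term is of order 2r \<ge> 2 in sin t and contributes nothing at the pole.\<close>
    then have "((\<lambda>t. H (sph t (\<alpha> + pi / 2))) has_real_derivative 0) (at 0)"
      by (intro along [OF has_vector_derivative_sph_theta]) (auto simp: sph_axis)
    moreover have "((\<lambda>t. H (sph t (\<alpha> + pi / 2))) has_real_derivative \<mu> * poly P' 1) (at 0)"
      unfolding H_sph using r by (auto intro!: derivative_eq_intros)
    ultimately have "\<mu> * poly P' 1 = 0" using DERIV_unique by blast
    then show False using \<mu> r by (simp add: poly_pderiv_legendre_1 add_eq_0_iff)
  next
    fix t assume "0 < t" "t < pi" "q = sph t \<alpha>"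
    then show False using H_meridian p(2) \<sigma>(2) H\<sigma> by fastforce
  next
    fix t u assume tu: "0 < t" "t < pi" "\<alpha> < u" "u < \<alpha> + pi" "q = sph t u"
    have s: "0 < sin (u - \<alpha>)" "0 < sin t ^ (2 * r)"
      using tu by (auto intro: sin_pos zero_less_power sin_gt_zero)
    have k0: "sin t ^ (2 * r) * sin (u - \<alpha>) \<noteq> 0" using mult_pos_pos [OF s(2,1)] by linarith
    have eq: "X t = Y u" using H_sign(1) [OF tu(1-4)] p(2) \<sigma>(2) H\<sigma> tu(5) by simp
    have "((\<lambda>t. H (sph t u)) has_real_derivative 0) (at t)"
      by (intro along [OF has_vector_derivative_sph_theta]) (auto simp: tu)
    then have "((\<lambda>t. (sin t ^ (2 * r) * sin (u - \<alpha>)) * (X t - Y u)) has_real_derivative 0) (at t)"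
      by (rule has_field_derivative_transform_within_open [of _ _ _ "{0<..<pi}"])
        (use tu s in \<open>auto intro: H_factor\<close>)
    moreover have "((\<lambda>t. sin t ^ (2 * r) * sin (u - \<alpha>)) has_real_derivative
        real (2 * r) * sin t ^ (2 * r - 1) * cos t * sin (u - \<alpha>)) (at t)"
      by (auto intro!: derivative_eq_intros)
    moreover have "((\<lambda>t. X t - Y u) has_real_derivative
        \<mu> * (N + 1) * poly g (cos t) / sin t ^ (2 * r) - 0) (at t)"
      using tu by (intro DERIV_diff X_deriv DERIV_const)
    ultimately have "\<mu> * (N + 1) * poly g (cos t) / sin t ^ (2 * r) - 0 = 0"
      by (rule DERIV_factor_zero) (use eq k0 in simp_all)
    moreover have "\<mu> * (N + 1) \<noteq> 0" using \<mu> N by auto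
    moreover have "sin t ^ (2 * r) \<noteq> 0" using s(2) by linarith
    ultimately have g0: "poly g (cos t) = 0" by (metis diff_zero divide_eq_0_iff mult_eq_0_iff)
    have "((\<lambda>u. H (sph t u)) has_real_derivative 0) (at u)"
      by (intro along [OF has_vector_derivative_sph_phi]) (auto simp: tu)
    then have "((\<lambda>u. (sin t ^ (2 * r) * sin (u - \<alpha>)) * (X t - Y u)) has_real_derivative 0) (at u)"
    proof (rule has_field_derivative_transform_within_open [of _ _ _ "{\<alpha><..<\<alpha> + pi}"])
      show "H (sph t v) = (sin t ^ (2 * r) * sin (v - \<alpha>)) * (X t - Y v)"
        if "v \<in> {\<alpha><..<\<alpha> + pi}" for v
        using H_factor [OF tu(1,2)] sin_pos [of v] that by force
    qed (use tu in auto)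
    moreover have "((\<lambda>u. sin t ^ (2 * r) * sin (u - \<alpha>)) has_real_derivative
        sin t ^ (2 * r) * cos (u - \<alpha>)) (at u)"
      by (auto intro!: derivative_eq_intros)
    moreover have "((\<lambda>u. X t - Y u) has_real_derivative 0 - - f u / (sin (u - \<alpha>))\<^sup>2) (at u)"
      using tu by (intro DERIV_diff Y_deriv DERIV_const)
    ultimately have "0 - - f u / (sin (u - \<alpha>))\<^sup>2 = 0"
      by (rule DERIV_factor_zero) (use eq k0 in simp_all)
    then have "f u = 0" using s by auto
    show False
      by (rule zigzag_pair_ex) (use g0 eq tu \<open>f u = 0\<close> in blast)
  qed
qed

lemma nodal_arc:
  obtains h where "continuous_on {\<alpha><..<\<alpha> + pi} h" "inj_on h {\<alpha><..<\<alpha> + pi}"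
    "h ` {\<alpha><..<\<alpha> + pi} = {p \<in> sphere2. H p = 0 \<and> 0 < side p}"
    "(h \<longlongrightarrow> - axis 3 1) (at_right \<alpha>)" "(h \<longlongrightarrow> - axis 3 1) (at_left (\<alpha> + pi))"
proof -
  obtain a M L e where "zigzag_pair X a M Y \<alpha> (\<alpha> + pi) L (2 * r) e"
    by (rule zigzag_pair_ex)
  then interpret zigzag_pair X a M Y \<alpha> "\<alpha> + pi" L "2 * r" e .
  obtain t u where tu: "continuous_on {\<alpha><..<\<alpha> + pi} t" "continuous_on {\<alpha><..<\<alpha> + pi} u"
    "inj_on (\<lambda>p. (t p, u p)) {\<alpha><..<\<alpha> + pi}"
    "(\<lambda>p. (t p, u p)) ` {\<alpha><..<\<alpha> + pi} =
      {(t, u). 0 < t \<and> t < pi \<and> \<alpha> < u \<and> u < \<alpha> + pi \<and> X t = Y u}"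
    "(t \<longlongrightarrow> pi) (at_right \<alpha>)" "(t \<longlongrightarrow> pi) (at_left (\<alpha> + pi))"
    using level_set_arc by blast
  have range: "0 < t p \<and> t p < pi \<and> \<alpha> < u p \<and> u p < \<alpha> + pi \<and> X (t p) = Y (u p)"
    if "p \<in> {\<alpha><..<\<alpha> + pi}" for p
    using imageI [OF that, of "\<lambda>p. (t p, u p)"] unfolding tu(4) by simp
  have lim: "((\<lambda>p. sph (t p) (u p)) \<longlongrightarrow> - axis 3 1) F" if F: "(t \<longlongrightarrow> pi) F" for F
  proof -
    \<comment> \<open>The distance to the south pole depends on the colatitude alone, so t -> pi
      suffices whatever the longitude does.\<close>
    have "norm (sph s v - - axis 3 1) = sqrt (2 + 2 * cos s)" for s v
    proof -
      have "sph s v \<bullet> sph s v = 1"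
        using sph_in_sphere2 [of s v] by (simp add: sphere2_def norm_eq_1)
      moreover have "sph s v \<bullet> axis 3 1 = cos s"
        by (simp add: inner_axis sph_def)
      ultimately show ?thesis
        by (simp add: norm_eq_sqrt_inner inner_add_left inner_add_right inner_commute inner_axis_axis)
    qed
    moreover have "((\<lambda>p. sqrt (2 + 2 * cos (t p))) \<longlongrightarrow> sqrt (2 + 2 * cos pi)) F"
      by (intro tendsto_intros F)
    ultimately have "((\<lambda>p. norm (sph (t p) (u p) - - axis 3 1)) \<longlongrightarrow> 0) F" by simp
    then show ?thesis using LIM_zero_cancel tendsto_norm_zero_iff by blast
  qed
  show ?thesis
  proof
    show "continuous_on {\<alpha><..<\<alpha> + pi} (\<lambda>p. sph (t p) (u p))"
      by (intro continuous_intros tu)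
    show "inj_on (\<lambda>p. sph (t p) (u p)) {\<alpha><..<\<alpha> + pi}"
    proof (rule inj_onI)
      fix p q assume pq: "p \<in> {\<alpha><..<\<alpha> + pi}" "q \<in> {\<alpha><..<\<alpha> + pi}" "sph (t p) (u p) = sph (t q) (u q)"
      then have "t p = t q \<and> u p = u q"
        using range [OF pq(1)] range [OF pq(2)] by (intro sph_inj [where a = \<alpha>]) auto
      then show "p = q" by (intro inj_onD [OF tu(3) _ pq(1,2)]) simp
    qed
    show "(\<lambda>p. sph (t p) (u p)) ` {\<alpha><..<\<alpha> + pi} = {p \<in> sphere2. H p = 0 \<and> 0 < side p}"
    proof (intro subset_antisym subsetI)
      fix q assume "q \<in> (\<lambda>p. sph (t p) (u p)) ` {\<alpha><..<\<alpha> + pi}"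
      then obtain p where p: "p \<in> {\<alpha><..<\<alpha> + pi}" "q = sph (t p) (u p)" by blast
      show "q \<in> {p \<in> sphere2. H p = 0 \<and> 0 < side p}"
        using range [OF p(1)] H_sign(1) [of "t p" "u p"] side_lune [of "t p" "u p"] sph_in_sphere2
        unfolding p(2) by blast
    next
      fix q assume "q \<in> {p \<in> sphere2. H p = 0 \<and> 0 < side p}"
      then obtain s v where sv: "0 < s" "s < pi" "\<alpha> < v" "v < \<alpha> + pi" "q = sph s v" "H q = 0"
        using lune_param [of q] by blast
      then have "(s, v) \<in> (\<lambda>p. (t p, u p)) ` {\<alpha><..<\<alpha> + pi}"
        unfolding tu(4) using H_sign(1) [of s v] by simp
      then show "q \<in> (\<lambda>p. sph (t p) (u p)) ` {\<alpha><..<\<alpha> + pi}" using sv(5) by auto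
    qed
  qed (use lim tu in blast)+
qed

text \<open>The antipodal image of this set is the other nodal curve, through the north
  pole.\<close>

definition south_curve :: "(real^3) set" where
  "south_curve = insert (- axis 3 1) {p \<in> sphere2. H p = 0 \<and> 0 < side p}"

lemma side_uminus: "side (- p) = - side p"
  by simp

lemma axis_in_sphere2: "axis 3 1 \<in> sphere2"
  by (simp add: sphere2_def)

lemma nodal_set_eq: "nodal_set H = south_curve \<union> uminus ` south_curve"
proof (intro subset_antisym subsetI)
  fix p assume "p \<in> nodal_set H"
  then have p: "p \<in> sphere2" "H p = 0" by (auto simp: nodal_set_def)
  consider "0 < side p" | "side p < 0" | "side p = 0" by linarith
  then show "p \<in> south_curve \<union> uminus ` south_curve"
  proof cases
    case 2
    then have "- p \<in> south_curve"
      using p side_uminus [of p] by (simp add: south_curve_def uminus_in_sphere2 H_uminus)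
    then show ?thesis by (metis UnI2 image_eqI minus_minus)
  next
    case 3
    then show ?thesis using great_circle [of p] p H_uminus by (force simp: south_curve_def)
  qed (use p in \<open>simp add: south_curve_def\<close>)
next
  have "south_curve \<subseteq> nodal_set H"
    using H_pole H_uminus [of "axis 3 1"] axis_in_sphere2 uminus_in_sphere2
    by (auto simp: south_curve_def nodal_set_def)
  moreover have "- p \<in> nodal_set H" if "p \<in> nodal_set H" for p
    using that by (simp add: nodal_set_def H_uminus uminus_in_sphere2)
  ultimately show "p \<in> nodal_set H" if "p \<in> south_curve \<union> uminus ` south_curve" for p
    using that by blast
qed

text \<open>\<open>side\<close> is nonnegative on the curve and nonpositive on its antipodal image.
  A common point would have \<open>side\<close> equal to 0 and so be both poles at once.\<close>

lemma south_curve_disjoint: "south_curve \<inter> uminus ` south_curve = {}"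
proof (rule equals0I)
  fix p assume "p \<in> south_curve \<inter> uminus ` south_curve"
  then have "p \<in> south_curve" "- p \<in> south_curve" by force+
  moreover have "(axis 3 1 :: real^3) \<noteq> - axis 3 1"
    by (metis axis_nth one_neq_neg_one vector_uminus_component)
  ultimately show False
    using side_uminus [of p] side_axis side_uminus [of "axis 3 1"]
    unfolding south_curve_def by (smt (verit) insert_iff mem_Collect_eq minus_minus)
qed

lemma south_curve_path:
  obtains \<gamma> where "simple_closed_curve \<gamma>" "path_image \<gamma> = south_curve"
proof -
  obtain h where h: "continuous_on {\<alpha><..<\<alpha> + pi} h" "inj_on h {\<alpha><..<\<alpha> + pi}"
    "h ` {\<alpha><..<\<alpha> + pi} = {p \<in> sphere2. H p = 0 \<and> 0 < side p}"
    "(h \<longlongrightarrow> - axis 3 1) (at_right \<alpha>)" "(h \<longlongrightarrow> - axis 3 1) (at_left (\<alpha> + pi))"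
    using nodal_arc by blast
  have "- axis 3 1 \<notin> h ` {\<alpha><..<\<alpha> + pi}"
    unfolding h(3) using side_axis side_uminus [of "axis 3 1"] by simp
  then show ?thesis
    using simple_closed_curve_of_arc [OF _ h(1,2) _ h(4,5)] that
    unfolding h(3) south_curve_def by auto
qed

lemma card_components_nodal_set: "card (components (nodal_set H)) = 2"
proof -
  obtain \<gamma> where \<gamma>: "simple_closed_curve \<gamma>" "path_image \<gamma> = south_curve" using south_curve_path .
  have closed: "closed (path_image \<delta>)" "connected (path_image \<delta>)" if "simple_closed_curve \<delta>" for \<delta>
    using that by (auto simp: simple_closed_curve_def closed_simple_path_image connected_simple_path_image)
  have C: "closed south_curve" "connected south_curve"
    "closed (uminus ` south_curve)" "connected (uminus ` south_curve)"
    using closed [OF \<gamma>(1)] closed [OF simple_closed_curve_uminus(1) [OF \<gamma>(1)]]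
    unfolding simple_closed_curve_uminus(2) [OF \<gamma>(1)] \<gamma>(2) by auto
  have ne: "- axis 3 1 \<in> south_curve" by (simp add: south_curve_def)
  have "components (nodal_set H) = {south_curve, uminus ` south_curve}"
  proof (rule components_eqI)
    show "\<Union> {south_curve, uminus ` south_curve} = nodal_set H" by (simp add: nodal_set_eq)
    show "pairwise disjnt {south_curve, uminus ` south_curve}"
      using south_curve_disjoint by (auto simp: pairwise_def disjnt_def)
    \<comment> \<open>Each curve is closed, so the other, being its complement in the nodal set, is
      relatively open.\<close>
    have "south_curve = nodal_set H - uminus ` south_curve" "uminus ` south_curve = nodal_set H - south_curve"
      using nodal_set_eq south_curve_disjoint by blast+
    then have "openin (top_of_set (nodal_set H)) south_curve"
      "openin (top_of_set (nodal_set H)) (uminus ` south_curve)"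
      using C by (metis openin_open_Int Diff_eq open_Compl)+
    then show "openin (top_of_set (nodal_set H)) C" if "C \<in> {south_curve, uminus ` south_curve}" for C
      using that by blast
  qed (use C ne in auto)
  moreover have "south_curve \<noteq> uminus ` south_curve" using ne south_curve_disjoint by blast
  ultimately show ?thesis by simp
qed

section \<open>Connectedness and number of the nodal domains\<close>

definition positive_set :: "(real^3) set" where
  "positive_set = {p \<in> sphere2. 0 < H p}"

text \<open>H is nonnegative on the great circle \<open>side\<close> = 0, so the negative set splits
  into this half and its antipodal image.\<close>

definition negative_lune :: "(real^3) set" where
  "negative_lune = {p \<in> sphere2. H p < 0 \<and> 0 < side p}"

lemma sph_continuous_pair: "continuous_on A (\<lambda>(t, u). sph t u)"
  unfolding case_prod_beta by (intro continuous_intros)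

lemma negative_lune_connected: "connected negative_lune" "negative_lune \<noteq> {}"
proof -
  obtain a M L e where "zigzag_pair X a M Y \<alpha> (\<alpha> + pi) L (2 * r) e"
    by (rule zigzag_pair_ex)
  then interpret zigzag_pair X a M Y \<alpha> "\<alpha> + pi" L "2 * r" e .
  let ?B = "{(t, u). 0 < t \<and> t < pi \<and> \<alpha> < u \<and> u < \<alpha> + pi \<and> X t < Y u}"
  have eq: "negative_lune = (\<lambda>(t, u). sph t u) ` ?B"
  proof (intro subset_antisym subsetI)
    fix p assume "p \<in> negative_lune"
    then have p: "p \<in> sphere2" "H p < 0" "0 < side p" by (auto simp: negative_lune_def)
    then obtain t u where tu: "0 < t" "t < pi" "\<alpha> < u" "u < \<alpha> + pi" "p = sph t u"
      using lune_param by blast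
    then have "(t, u) \<in> ?B" using H_sign(3) [of t u] p by simp
    then show "p \<in> (\<lambda>(t, u). sph t u) ` ?B" unfolding tu(5) by (rule rev_image_eqI) simp
  next
    fix p assume "p \<in> (\<lambda>(t, u). sph t u) ` ?B"
    then obtain t u where tu: "0 < t" "t < pi" "\<alpha> < u" "u < \<alpha> + pi" "X t < Y u" "p = sph t u"
      by auto
    then show "p \<in> negative_lune"
      unfolding negative_lune_def mem_Collect_eq tu(6)
      using H_sign(3) [of t u] side_lune [of t u] sph_in_sphere2 by blast
  qed
  show "connected negative_lune"
    unfolding eq by (rule connected_continuous_image [OF sph_continuous_pair below_connected])
  obtain t where "0 < t" "t < pi" "- Y (\<alpha> + pi / 2) < X t"
    using X_unbounded [OF pi_gt_zero] by blast
  then have "(pi - t, \<alpha> + pi / 2) \<in> ?B" using X_odd [of t] by simp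
  then show "negative_lune \<noteq> {}" unfolding eq by blast
qed

text \<open>Y tends to minus infinity at both ends of the lune, so the positive part of the open
  lune accumulates at every inner point of the bounding meridians. Adding these points keeps it
  connected, and the resulting half K meets - K there.\<close>

lemma positive_set_connected: "connected positive_set" "sph (pi / 2) \<alpha> \<in> positive_set"
proof -
  obtain a M L e where "zigzag_pair X a M Y \<alpha> (\<alpha> + pi) L (2 * r) e"
    by (rule zigzag_pair_ex)
  then interpret zigzag_pair X a M Y \<alpha> "\<alpha> + pi" L "2 * r" e .
  let ?A = "{(t, u). 0 < t \<and> t < pi \<and> \<alpha> < u \<and> u < \<alpha> + pi \<and> Y u < X t}"
  let ?E = "(\<lambda>(t, u). sph t u) ` ?A"
  define K where "K = {p \<in> sphere2. 0 < H p \<and> 0 \<le> side p}"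
  have E: "connected ?E"
    by (rule connected_continuous_image [OF sph_continuous_pair above_connected])
  have E_K: "?E \<subseteq> K"
  proof
    fix p assume "p \<in> ?E"
    then obtain t u where tu: "0 < t" "t < pi" "\<alpha> < u" "u < \<alpha> + pi" "Y u < X t" "p = sph t u"
      by auto
    then show "p \<in> K"
      unfolding K_def mem_Collect_eq tu(6)
      using H_sign(2) [of t u] side_lune [of t u] sph_in_sphere2 less_imp_le by blast
  qed
  have lim: "sph t b \<in> closure ?E"
    if t: "0 < t" "t < pi" and F: "filterlim Y at_bot F" "F \<noteq> bot" "((\<lambda>u. u) \<longlongrightarrow> b) F"
      "eventually (\<lambda>u. u \<in> {\<alpha><..<\<alpha> + pi}) F" for t b F
  proof (rule Lim_in_closed_set [OF closed_closure _ F(2)])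
    have "eventually (\<lambda>u. Y u < X t) F" using F(1) filterlim_at_bot_dense by blast
    with F(4) have "eventually (\<lambda>u. sph t u \<in> ?E) F"
    proof eventually_elim
      case (elim u)
      then have "(t, u) \<in> ?A" using t by simp
      then show ?case by (rule rev_image_eqI) simp
    qed
    then show "eventually (\<lambda>u. sph t u \<in> closure ?E) F"
      by (rule eventually_mono) (rule subsetD [OF closure_subset])
    show "((\<lambda>u. sph t u) \<longlongrightarrow> sph t b) F"
      unfolding sph_axis by (intro tendsto_intros F(3))
  qed
  have lim_left: "sph t \<alpha> \<in> closure ?E" if "0 < t" "t < pi" for t
    using that Y_lim_ends(1)
    by (rule lim) (use eventually_at_right_real [of \<alpha> "\<alpha> + pi"] in \<open>simp_all add: tendsto_ident_at\<close>)
  have lim_right: "sph t (\<alpha> + pi) \<in> closure ?E" if "0 < t" "t < pi" for t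
    using that Y_lim_ends(2)
    by (rule lim) (use eventually_at_left_real [of \<alpha> "\<alpha> + pi"] in \<open>simp_all add: tendsto_ident_at\<close>)
  have "K \<subseteq> closure ?E"
  proof
    fix p assume "p \<in> K"
    then have p: "p \<in> sphere2" "0 < H p" "0 \<le> side p" by (auto simp: K_def)
    show "p \<in> closure ?E"
    proof (cases "side p = 0")
      case True
      have "H (- axis 3 1) = 0" using H_pole H_uminus by simp
      then have "p \<noteq> axis 3 1" "p \<noteq> - axis 3 1" using H_pole p(2) by (metis less_irrefl)+
      then obtain t where t: "0 < t" "t < pi" "p = sph t \<alpha> \<or> p = - sph t \<alpha>"
        using great_circle [OF p(1) True] by blast
      have "- sph t \<alpha> = sph (pi - t) (\<alpha> + pi)" by (simp only: sph_antipode)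
      then show ?thesis using t lim_left [of t] lim_right [of "pi - t"] by auto
    next
      case False
      then obtain t u where tu: "0 < t" "t < pi" "\<alpha> < u" "u < \<alpha> + pi" "p = sph t u"
        using p lune_param [of p] by (metis less_eq_real_def)
      then have "(t, u) \<in> ?A" using H_sign(2) [of t u] p by simp
      then have "p \<in> ?E" unfolding tu(5) by (rule rev_image_eqI) simp
      then show ?thesis by (rule subsetD [OF closure_subset])
    qed
  qed
  then have K: "connected K" by (rule connected_intermediate_closure [OF E E_K])
  have mer: "sph (pi / 2) \<alpha> \<in> K" "- sph (pi / 2) \<alpha> \<in> K"
  proof -
    have "side (sph (pi / 2) \<alpha>) = 0" unfolding side_sph by simp
    moreover have "0 < H (sph (pi / 2) \<alpha>)" by (rule H_meridian) auto
    ultimately show "sph (pi / 2) \<alpha> \<in> K" "- sph (pi / 2) \<alpha> \<in> K"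
      using sph_in_sphere2 uminus_in_sphere2 side_uminus
      unfolding K_def mem_Collect_eq H_uminus by auto
  qed
  have eq: "positive_set = K \<union> uminus ` K"
  proof (intro subset_antisym subsetI)
    fix p assume p: "p \<in> positive_set"
    show "p \<in> K \<union> uminus ` K"
    proof (cases "0 \<le> side p")
      case True
      then show ?thesis using p by (simp add: positive_set_def K_def)
    next
      case False
      then have "- p \<in> K"
        using p side_uminus [of p] by (simp add: positive_set_def K_def H_uminus uminus_in_sphere2)
      then show ?thesis by (metis UnI2 image_eqI minus_minus)
    qed
  next
    fix p assume "p \<in> K \<union> uminus ` K"
    then show "p \<in> positive_set"
      by (auto simp: K_def positive_set_def H_uminus uminus_in_sphere2)
  qed
  have "connected (uminus ` K)"
    using K by (rule connected_continuous_image [rotated]) (intro continuous_intros)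
  moreover have "sph (pi / 2) \<alpha> \<in> K \<inter> uminus ` K"
    using mer by (metis IntI image_eqI minus_minus)
  ultimately show "connected positive_set" unfolding eq using K by (intro connected_Un) blast+
  show "sph (pi / 2) \<alpha> \<in> positive_set" using mer unfolding eq by blast
qed

lemma card_nodal_domains: "card (nodal_domains H) = 3"
proof -
  let ?S = "sphere2 - nodal_set H"
  let ?F = "{positive_set, negative_lune, uminus ` negative_lune}"
  have S: "?S = {p \<in> sphere2. H p \<noteq> 0}" by (auto simp: nodal_set_def)
  have neg': "uminus ` negative_lune = {p \<in> sphere2. H p < 0 \<and> side p < 0}"
  proof (intro subset_antisym subsetI)
    fix p assume p: "p \<in> {p \<in> sphere2. H p < 0 \<and> side p < 0}"
    then have "- p \<in> negative_lune"
      using side_uminus [of p] by (simp add: negative_lune_def H_uminus uminus_in_sphere2)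
    then show "p \<in> uminus ` negative_lune" by (metis image_eqI minus_minus)
  qed (auto simp: negative_lune_def H_uminus uminus_in_sphere2)
  have side_ne: "side p \<noteq> 0" if "p \<in> sphere2" "H p < 0" for p
  proof
    assume "side p = 0"
    then have "0 \<le> H p" using great_circle [OF that(1)] H_pole H_uminus [of "axis 3 1"] by auto
    then show False using that(2) by simp
  qed
  have H_open: "open {p. 0 < H p}" "open {p. H p < 0}"
    using H_cont [of UNIV] by (auto intro!: open_Collect_less continuous_on_const)
  have side_cont: "continuous_on UNIV side" by (intro continuous_intros)
  have side_open: "open {p. 0 < side p}" "open {p. side p < 0}"
    by (rule open_Collect_less [OF continuous_on_const side_cont],
        rule open_Collect_less [OF side_cont continuous_on_const])
  have "components ?S = ?F"
  proof (rule components_eqI)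
    show "\<Union> ?F = ?S"
    proof (intro subset_antisym subsetI)
      fix p assume "p \<in> ?S"
      then have p: "p \<in> sphere2" "H p \<noteq> 0" unfolding S by auto
      then have "0 < H p \<or> H p < 0 \<and> 0 < side p \<or> H p < 0 \<and> side p < 0"
        using side_ne [of p] by linarith
      then show "p \<in> \<Union> ?F"
        unfolding neg' using p(1) by (auto simp: positive_set_def negative_lune_def)
    qed (unfold S neg', auto simp: positive_set_def negative_lune_def)
    show "pairwise disjnt ?F"
      unfolding neg' by (auto simp: pairwise_def disjnt_def positive_set_def negative_lune_def)
    have "connected (uminus ` negative_lune)"
      using negative_lune_connected(1)
      by (rule connected_continuous_image [rotated]) (intro continuous_intros)
    then show "connected C" if "C \<in> ?F" for C
      using that positive_set_connected(1) negative_lune_connected(1) by blast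
    show "C \<noteq> {}" if "C \<in> ?F" for C
      using that positive_set_connected(2) negative_lune_connected(2) by blast
    have F_eq: "positive_set = ?S \<inter> {p. 0 < H p}" "negative_lune = ?S \<inter> ({p. H p < 0} \<inter> {p. 0 < side p})"
      "uminus ` negative_lune = ?S \<inter> ({p. H p < 0} \<inter> {p. side p < 0})"
      unfolding S neg' by (auto simp: positive_set_def negative_lune_def)
    have "openin (top_of_set ?S) positive_set"
      by (subst F_eq(1)) (intro openin_open_Int H_open)
    moreover have "openin (top_of_set ?S) negative_lune"
      by (subst F_eq(2)) (intro openin_open_Int open_Int H_open side_open)
    moreover have "openin (top_of_set ?S) (uminus ` negative_lune)"
      by (subst F_eq(3)) (intro openin_open_Int open_Int H_open side_open)
    ultimately show "openin (top_of_set ?S) C" if "C \<in> ?F" for C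
      using that by blast
  qed
  moreover have "card ?F = 3"
  proof -
    have "positive_set \<inter> negative_lune = {}" "positive_set \<inter> uminus ` negative_lune = {}"
      "negative_lune \<inter> uminus ` negative_lune = {}"
      unfolding neg' by (auto simp: positive_set_def negative_lune_def)
    then have "positive_set \<noteq> negative_lune" "positive_set \<noteq> uminus ` negative_lune"
      "negative_lune \<noteq> uminus ` negative_lune"
      using positive_set_connected(2) negative_lune_connected(2) by blast+
    then show ?thesis by simp
  qed
  ultimately show ?thesis by (simp add: nodal_domains_def)
qed

end

theorem proposition2:
  fixes r :: nat and \<epsilon> \<alpha> \<mu> :: real
  assumes "r \<ge> 1"
    and "0 < \<epsilon>" and "\<epsilon> < 1 / 2"
    and "\<alpha> = \<epsilon> * pi / (2 * real r)"
    and "0 < \<mu>" and "ereal \<mu> < mu_c r \<alpha>"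
  shows "spherical_harmonic (2 * r) (harm_H r \<alpha> \<mu>) \<and>
    (\<forall>\<theta>\<in>{0..pi}. \<forall>\<phi>. harm_H r \<alpha> \<mu> (sph \<theta> \<phi>) =
       sin \<theta> ^ (2 * r) * sin (real (2 * r) * \<phi>)
         + \<mu> * sin \<theta> * poly (pderiv (legendre (2 * r))) (cos \<theta>) * sin (\<phi> - \<alpha>)) \<and>
    (\<nexists>p. critical_zero (harm_H r \<alpha> \<mu>) p) \<and>
    card (components (nodal_set (harm_H r \<alpha> \<mu>))) = 2 \<and>
    (\<exists>\<gamma>\<^sub>1 \<gamma>\<^sub>2. simple_closed_curve \<gamma>\<^sub>1 \<and> simple_closed_curve \<gamma>\<^sub>2 \<and>
       path_image \<gamma>\<^sub>1 \<inter> path_image \<gamma>\<^sub>2 = {} \<and>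
       nodal_set (harm_H r \<alpha> \<mu>) = path_image \<gamma>\<^sub>1 \<union> path_image \<gamma>\<^sub>2) \<and>
    card (nodal_domains (harm_H r \<alpha> \<mu>)) = 3"
proof -
  have "small_perturbation r \<alpha> \<mu>"
  proof
    have "2 * real r * \<alpha> = \<epsilon> * pi" using assms(1,4) by simp
    also have "\<dots> < 1 / 2 * pi" using assms(3) by (intro mult_strict_right_mono) auto
    finally show "2 * real r * \<alpha> < pi / 2" by simp
    show "0 < \<alpha>" using assms(1,2,4) by simp
  qed (use assms in auto)
  then interpret small_perturbation r \<alpha> \<mu> .
  obtain \<gamma> where \<gamma>: "simple_closed_curve \<gamma>" "path_image \<gamma> = south_curve" using south_curve_path .
  note \<gamma>' = simple_closed_curve_uminus [OF \<gamma>(1), unfolded \<gamma>(2)]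
  have "\<exists>\<gamma>\<^sub>1 \<gamma>\<^sub>2. simple_closed_curve \<gamma>\<^sub>1 \<and> simple_closed_curve \<gamma>\<^sub>2 \<and>
      path_image \<gamma>\<^sub>1 \<inter> path_image \<gamma>\<^sub>2 = {} \<and> nodal_set H = path_image \<gamma>\<^sub>1 \<union> path_image \<gamma>\<^sub>2"
    using \<gamma> \<gamma>' nodal_set_eq south_curve_disjoint by metis
  then show ?thesis
    using spherical_harmonic_harm_H H_sph no_critical_zero card_components_nodal_set card_nodal_domains
    by blast
qed

end
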